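(* Let $K$ be an AEC and $M\prec N$ models such that $M$ is $\kappa$-saturated. If there is $p\in S(N)$ that is an heir over $M$ and also forks over $M$, then $K$ has the $(\kappa,\kappa)$-order$_2$ property, and it is witnessed in $M$ (i.e. the witnessing tuples $b_i$ and models $N_i$ can be taken inside $M$).
   Context: $K$ is an AEC with strong substructure $\prec$ and Löwenheim–Skolem number $LS(K)$, with amalgamation, joint embedding and no maximal models; one works in a monster model $\mathfrak{C}$. Galois type $tp(\bar a/M)$ = orbit of a sequence under automorphisms of $\mathfrak{C}$ fixing $M$ pointwise; $S(N)$ = Galois types over $N$; $p^{I_0}$, $p\upharpoonright N$ restrictions. A fixed cardinal $\kappa>LS(K)$; "small" = of size/length $<\kappa$. Non-forking: $A\downarrow_{M_0}N$ iff for every subsequence $a$ of $A$ of length $<\kappa$ and every $N^-\prec N$ with $\|N^-\|<\kappa$, $tp(a/N^-)$ is realized in $M_0$; $p\in S(N)$ forks over $M_0$ iff a realization $A$ fails $A\downarrow_{M_0}N$. $M$ is $\kappa$-saturated iff every type over any $N'\prec M$ with $\|N'\|<\kappa$ is realized in $M$. Heir: $p\in S^I(N)$ is an heir over $M\prec N$ iff for all small $I_0\subseteq I$, small $M^-\prec M$ (possibly empty), and small $N^-$ with $M^-\prec N^-\prec N$, there is a $K$-embedding $f:N^-\to M$ fixing $M^-$ with $f(p^{I_0}\upharpoonright N^-)=p^{I_0}\upharpoonright f(N^-)$. $(\lambda,\alpha)$-order$_2$ property: there are a tuple $b$, tuples $\langle b_i:i<\alpha\rangle$ and models $\langle N_i\in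 K:i<\alpha\rangle$ with $\ell(b_i)+\|N_i\|<\lambda$ such that for all $i,j<\alpha$: $i\le j$ iff $b_j$ realizes $tp(b/N_i)$. *)

theory Defs
  imports Main
begin

unbundle cardinal_syntax

section \<open>Structures\<close>

record ('f, 'r) language =
  fsyms :: "'f set"
  rsyms :: "'r set"
  far :: "'f \<Rightarrow> nat"
  rar :: "'r \<Rightarrow> nat"

record ('f, 'r, 'a) struct =
  univ :: "'a set"
  fint :: "'f \<Rightarrow> 'a list \<Rightarrow> 'a"
  rint :: "'r \<Rightarrow> 'a list \<Rightarrow> bool"

definition args :: "nat \<Rightarrow> 'a set \<Rightarrow> 'a list set" where
  "args n A = {xs. set xs \<subseteq> A \<and> length xs = n}"

text \<open>The two junk-value clauses make a structure determined by its universe and by its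
  interpretations of the symbols of the language, so that HOL equality is equality of structures.\<close>

definition is_struct :: "('f, 'r) language \<Rightarrow> ('f, 'r, 'a) struct \<Rightarrow> bool" where
  "is_struct L M \<longleftrightarrow>
     univ M \<noteq> {} \<and>
     (\<forall>F\<in>fsyms L. \<forall>xs\<in>args (far L F) (univ M). fint M F xs \<in> univ M) \<and>
     (\<forall>F xs. \<not> (F \<in> fsyms L \<and> xs \<in> args (far L F) (univ M)) \<longrightarrow> fint M F xs = undefined) \<and>
     (\<forall>R xs. \<not> (R \<in> rsyms L \<and> xs \<in> args (rar L R) (univ M)) \<longrightarrow> \<not> rint M R xs)"

definition substruct ::
  "('f, 'r) language \<Rightarrow> ('f, 'r, 'a) struct \<Rightarrow> ('f, 'r, 'a) struct \<Rightarrow> bool" where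
  "substruct L M N \<longleftrightarrow>
     is_struct L M \<and> is_struct L N \<and> univ M \<subseteq> univ N \<and>
     (\<forall>F\<in>fsyms L. \<forall>xs\<in>args (far L F) (univ M). fint M F xs = fint N F xs) \<and>
     (\<forall>R\<in>rsyms L. \<forall>xs\<in>args (rar L R) (univ M). rint M R xs \<longleftrightarrow> rint N R xs)"

text \<open>Only the values of \<open>f\<close> on the universe of \<open>M\<close> matter.\<close>

definition struct_iso ::
  "('f, 'r) language \<Rightarrow> ('a \<Rightarrow> 'a) \<Rightarrow> ('f, 'r, 'a) struct \<Rightarrow> ('f, 'r, 'a) struct \<Rightarrow> bool" where
  "struct_iso L f M N \<longleftrightarrow>
     is_struct L M \<and> is_struct L N \<and> bij_betw f (univ M) (univ N) \<and>
     (\<forall>F\<in>fsyms L. \<forall>xs\<in>args (far L F) (univ M). f (fint M F xs) = fint N F (map f xs)) \<and>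
     (\<forall>R\<in>rsyms L. \<forall>xs\<in>args (rar L R) (univ M). rint M R xs \<longleftrightarrow> rint N R (map f xs))"


section \<open>Abstract elementary classes\<close>

text \<open>A class is represented by its members whose universe is a set of elements of the
  type \<open>'a\<close>.\<close>

record ('f, 'r, 'a) class_data =
  lang :: "('f, 'r) language"
  models :: "('f, 'r, 'a) struct set"
  strong :: "('f, 'r, 'a) struct \<Rightarrow> ('f, 'r, 'a) struct \<Rightarrow> bool"

abbreviation strong_syntax ::
  "('f, 'r, 'a) struct \<Rightarrow> ('f, 'r, 'a) class_data \<Rightarrow> ('f, 'r, 'a) struct \<Rightarrow> bool"
  (\<open>(_ \<preceq>\<^bsub>_\<^esub> _)\<close> [51, 0, 51] 50) where
  "M \<preceq>\<^bsub>K\<^esub> N \<equiv> strong K M N"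

text \<open>Increasing continuous chains indexed by the ordinal \<open>r\<close>. The antecedent of the last clause
  says that \<open>i\<close> is a limit. Since \<open>Ms j\<close> is a substructure of \<open>Ms i\<close> for \<open>j < i\<close>, it is enough
  to compare universes there.\<close>

definition continuous_chain ::
  "('f, 'r, 'a) class_data \<Rightarrow> 'o rel \<Rightarrow> ('o \<Rightarrow> ('f, 'r, 'a) struct) \<Rightarrow> bool" where
  "continuous_chain K r Ms \<longleftrightarrow>
     Well_order r \<and> Field r \<noteq> {} \<and>
     (\<forall>i\<in>Field r. Ms i \<in> models K) \<and>
     (\<forall>i j. (i, j) \<in> r \<longrightarrow> Ms i \<preceq>\<^bsub>K\<^esub> Ms j) \<and>
     (\<forall>i\<in>Field r.
        underS r i \<noteq> {} \<and> (\<forall>j\<in>underS r i. \<exists>k\<in>underS r i. j \<in> underS r k) \<longrightarrow>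
        univ (Ms i) = (\<Union>j\<in>underS r i. univ (Ms j)))"

definition LS_property :: "('f, 'r, 'a) class_data \<Rightarrow> 'l rel \<Rightarrow> bool" where
  "LS_property K l \<longleftrightarrow>
     Card_order l \<and> natLeq \<le>o l \<and> |fsyms (lang K)| +c |rsyms (lang K)| \<le>o l \<and>
     (\<forall>M\<in>models K. \<forall>A\<subseteq>univ M. \<exists>N. N \<preceq>\<^bsub>K\<^esub> M \<and> A \<subseteq> univ N \<and> |univ N| \<le>o |A| +c l)"

text \<open>Every cardinal below \<open>l\<close> is isomorphic to one on the type of \<open>l\<close>, hence minimality among
  the cardinals on that type is minimality among all cardinals.\<close>

definition is_LS_number :: "('f, 'r, 'a) class_data \<Rightarrow> 'l rel \<Rightarrow> bool" where
  "is_LS_number K l \<longleftrightarrow> LS_property K l \<and> (\<forall>l' :: 'l rel. LS_property K l' \<longrightarrow> l \<le>o l')"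

text \<open>In the chain axiom, \<open>U\<close> is the union of the chain: symbols have finite arity, so the
  structure on the union of the universes is determined by \<open>Ms i\<close> being a substructure of \<open>U\<close>
  for all \<open>i\<close>. Indexing by well-orders on the type \<open>'a\<close> loses no generality when that type is
  infinite: a strictly increasing chain of subsets of \<open>'a\<close> has length below the successor of
  the cardinality of \<open>'a\<close>.\<close>

definition is_aec :: "('f, 'r, 'a) class_data \<Rightarrow> 'l rel \<Rightarrow> bool" where
  "is_aec K l \<longleftrightarrow>
     (\<forall>M\<in>models K. is_struct (lang K) M) \<and>
     (\<forall>M N. M \<preceq>\<^bsub>K\<^esub> N \<longrightarrow> M \<in> models K \<and> N \<in> models K \<and> substruct (lang K) M N) \<and>
     (\<forall>M\<in>models K. M \<preceq>\<^bsub>K\<^esub> M) \<and>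
     (\<forall>M N P. M \<preceq>\<^bsub>K\<^esub> N \<and> N \<preceq>\<^bsub>K\<^esub> P \<longrightarrow> M \<preceq>\<^bsub>K\<^esub> P) \<and>
     (\<forall>M N f. M \<in> models K \<and> struct_iso (lang K) f M N \<longrightarrow> N \<in> models K) \<and>
     (\<forall>M N M' N' f. M \<preceq>\<^bsub>K\<^esub> N \<and> struct_iso (lang K) f N N' \<and> struct_iso (lang K) f M M'
        \<longrightarrow> M' \<preceq>\<^bsub>K\<^esub> N') \<and>
     (\<forall>M N P. M \<preceq>\<^bsub>K\<^esub> P \<and> N \<preceq>\<^bsub>K\<^esub> P \<and> substruct (lang K) M N \<longrightarrow> M \<preceq>\<^bsub>K\<^esub> N) \<and>
     (\<forall>(r :: 'a rel) Ms. continuous_chain K r Ms \<longrightarrow>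
        (\<exists>U\<in>models K. univ U = (\<Union>i\<in>Field r. univ (Ms i)) \<and>
           (\<forall>i\<in>Field r. Ms i \<preceq>\<^bsub>K\<^esub> U) \<and>
           (\<forall>N. (\<forall>i\<in>Field r. Ms i \<preceq>\<^bsub>K\<^esub> N) \<longrightarrow> U \<preceq>\<^bsub>K\<^esub> N))) \<and>
     is_LS_number K l"

definition K_embedding ::
  "('f, 'r, 'a) class_data \<Rightarrow> ('a \<Rightarrow> 'a) \<Rightarrow> ('f, 'r, 'a) struct \<Rightarrow> ('f, 'r, 'a) struct \<Rightarrow> bool" where
  "K_embedding K f M N \<longleftrightarrow> (\<exists>M'. struct_iso (lang K) f M M' \<and> M' \<preceq>\<^bsub>K\<^esub> N)"

definition amalgamation :: "('f, 'r, 'a) class_data \<Rightarrow> bool" where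
  "amalgamation K \<longleftrightarrow>
     (\<forall>M0 M1 M2. M0 \<preceq>\<^bsub>K\<^esub> M1 \<and> M0 \<preceq>\<^bsub>K\<^esub> M2 \<longrightarrow>
        (\<exists>N f1 f2. K_embedding K f1 M1 N \<and> K_embedding K f2 M2 N \<and>
           (\<forall>x\<in>univ M0. f1 x = f2 x)))"

definition joint_embedding :: "('f, 'r, 'a) class_data \<Rightarrow> bool" where
  "joint_embedding K \<longleftrightarrow>
     (\<forall>M1\<in>models K. \<forall>M2\<in>models K. \<exists>N f1 f2. K_embedding K f1 M1 N \<and> K_embedding K f2 M2 N)"

text \<open>Proper extensions are taken up to isomorphism: a model whose universe is the whole
  type \<open>'a\<close> has no proper extension by inclusion, but it can be isomorphic to a proper strong
  substructure of another model on \<open>'a\<close>.\<close>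

definition no_maximal_models :: "('f, 'r, 'a) class_data \<Rightarrow> bool" where
  "no_maximal_models K \<longleftrightarrow>
     (\<forall>M\<in>models K. \<exists>N f. K_embedding K f M N \<and> f ` univ M \<noteq> univ N)"


section \<open>The monster model and Galois types\<close>

text \<open>Together the two conditions give model homogeneity: if \<open>M \<preceq> N\<close> have size below \<open>\<mu>\<close> and
  \<open>M \<preceq> \<CC>\<close>, then \<open>N\<close> embeds into \<open>\<CC>\<close> over \<open>M\<close>.\<close>

definition monster :: "('f, 'r, 'a) class_data \<Rightarrow> 'm rel \<Rightarrow> ('f, 'r, 'a) struct \<Rightarrow> bool" where
  "monster K \<mu> \<CC> \<longleftrightarrow>
     \<CC> \<in> models K \<and>
     (\<forall>M\<in>models K. |univ M| <o \<mu> \<longrightarrow> (\<exists>f. K_embedding K f M \<CC>)) \<and>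
     (\<forall>M M' f. M \<preceq>\<^bsub>K\<^esub> \<CC> \<and> M' \<preceq>\<^bsub>K\<^esub> \<CC> \<and> |univ M| <o \<mu> \<and> struct_iso (lang K) f M M' \<longrightarrow>
        (\<exists>g. struct_iso (lang K) g \<CC> \<CC> \<and> (\<forall>x\<in>univ M. g x = f x)))"

text \<open>A sequence \<open>(a\<^sub>i : i \<in> I)\<close> is a partial function with domain \<open>I\<close>; its subsequence with index
  set \<open>I0\<close> is \<open>a |` I0\<close>, and its image under \<open>g\<close> is \<open>map_option g \<circ> a\<close>. A Galois type is an orbit,
  that is, the set of its realizations.\<close>

definition gtp ::
  "('f, 'r, 'a) class_data \<Rightarrow> ('f, 'r, 'a) struct \<Rightarrow> ('i \<rightharpoonup> 'a) \<Rightarrow> 'a set \<Rightarrow> ('i \<rightharpoonup> 'a) set" where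
  "gtp K \<CC> a A = {map_option g \<circ> a | g. struct_iso (lang K) g \<CC> \<CC> \<and> (\<forall>x\<in>A. g x = x)}"

definition gS ::
  "('f, 'r, 'a) class_data \<Rightarrow> ('f, 'r, 'a) struct \<Rightarrow> 'i set \<Rightarrow> ('f, 'r, 'a) struct
     \<Rightarrow> ('i \<rightharpoonup> 'a) set set" where
  "gS K \<CC> I N = {gtp K \<CC> a (univ N) | a. dom a = I \<and> ran a \<subseteq> univ \<CC>}"

definition type_sub :: "('i \<rightharpoonup> 'a) set \<Rightarrow> 'i set \<Rightarrow> ('i \<rightharpoonup> 'a) set" where
  "type_sub p I0 = (\<lambda>a. a |` I0) ` p"

text \<open>If \<open>p\<close> is the type of \<open>a\<close> over a set containing \<open>A\<close>, this is the type of \<open>a\<close> over \<open>A\<close>.\<close>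

definition type_restrict ::
  "('f, 'r, 'a) class_data \<Rightarrow> ('f, 'r, 'a) struct \<Rightarrow> ('i \<rightharpoonup> 'a) set \<Rightarrow> 'a set \<Rightarrow> ('i \<rightharpoonup> 'a) set" where
  "type_restrict K \<CC> p A = (\<Union>a\<in>p. gtp K \<CC> a A)"

text \<open>If \<open>p\<close> is the type of \<open>a\<close> over \<open>A\<close>, this is the type of \<open>g a\<close> over \<open>f ` A\<close> for any
  automorphism \<open>g\<close> of \<open>\<CC>\<close> extending \<open>f\<close> on \<open>A\<close>.\<close>

definition type_image ::
  "('f, 'r, 'a) class_data \<Rightarrow> ('f, 'r, 'a) struct \<Rightarrow> ('a \<Rightarrow> 'a) \<Rightarrow> 'a set
     \<Rightarrow> ('i \<rightharpoonup> 'a) set \<Rightarrow> ('i \<rightharpoonup> 'a) set" where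
  "type_image K \<CC> f A p =
     {map_option g \<circ> a | g a. a \<in> p \<and> struct_iso (lang K) g \<CC> \<CC> \<and> (\<forall>x\<in>A. g x = f x)}"

text \<open>Saturation is about types of single elements; types of sequences are not required to be
  realized.\<close>

definition saturated ::
  "('f, 'r, 'a) class_data \<Rightarrow> ('f, 'r, 'a) struct \<Rightarrow> 'k rel \<Rightarrow> ('f, 'r, 'a) struct \<Rightarrow> bool" where
  "saturated K \<CC> \<kappa> M \<longleftrightarrow>
     (\<forall>N'. N' \<preceq>\<^bsub>K\<^esub> M \<and> |univ N'| <o \<kappa> \<longrightarrow>
        (\<forall>p\<in>gS K \<CC> {()} N'. \<exists>c\<in>p. ran c \<subseteq> univ M))"


section \<open>Non-forking, heirs and the order property\<close>

definition nonforking ::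
  "('f, 'r, 'a) class_data \<Rightarrow> ('f, 'r, 'a) struct \<Rightarrow> 'k rel \<Rightarrow> ('i \<rightharpoonup> 'a)
     \<Rightarrow> ('f, 'r, 'a) struct \<Rightarrow> ('f, 'r, 'a) struct \<Rightarrow> bool" where
  "nonforking K \<CC> \<kappa> A M0 N \<longleftrightarrow>
     (\<forall>I0\<subseteq>dom A. \<forall>N'. |I0| <o \<kappa> \<and> N' \<preceq>\<^bsub>K\<^esub> N \<and> |univ N'| <o \<kappa> \<longrightarrow>
        (\<exists>c\<in>gtp K \<CC> (A |` I0) (univ N'). ran c \<subseteq> univ M0))"

definition forks_over ::
  "('f, 'r, 'a) class_data \<Rightarrow> ('f, 'r, 'a) struct \<Rightarrow> 'k rel \<Rightarrow> ('i \<rightharpoonup> 'a) set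
     \<Rightarrow> ('f, 'r, 'a) struct \<Rightarrow> ('f, 'r, 'a) struct \<Rightarrow> bool" where
  "forks_over K \<CC> \<kappa> p M0 N \<longleftrightarrow> (\<exists>A\<in>p. \<not> nonforking K \<CC> \<kappa> A M0 N)"

text \<open>\<open>X\<close> is the universe of the small strong substructure of \<open>M\<close> that has to be fixed, or empty.\<close>

definition heir_over ::
  "('f, 'r, 'a) class_data \<Rightarrow> ('f, 'r, 'a) struct \<Rightarrow> 'k rel \<Rightarrow> 'i set \<Rightarrow> ('i \<rightharpoonup> 'a) set
     \<Rightarrow> ('f, 'r, 'a) struct \<Rightarrow> ('f, 'r, 'a) struct \<Rightarrow> bool" where
  "heir_over K \<CC> \<kappa> I p M N \<longleftrightarrow>
     (\<forall>I0\<subseteq>I. \<forall>X N'.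
        |I0| <o \<kappa> \<and>
        (X = {} \<or> (\<exists>M'. X = univ M' \<and> |univ M'| <o \<kappa> \<and> M' \<preceq>\<^bsub>K\<^esub> M \<and> M' \<preceq>\<^bsub>K\<^esub> N')) \<and>
        N' \<preceq>\<^bsub>K\<^esub> N \<and> |univ N'| <o \<kappa> \<longrightarrow>
        (\<exists>f. K_embedding K f N' M \<and> (\<forall>x\<in>X. f x = x) \<and>
           type_image K \<CC> f (univ N') (type_restrict K \<CC> (type_sub p I0) (univ N')) =
           type_restrict K \<CC> (type_sub p I0) (f ` univ N')))"

text \<open>Sequences of ordinal length below the cardinal \<open>\<theta>\<close>: the ordinals below \<open>\<theta>\<close> are its proper
  initial segments.\<close>

definition is_tuple :: "'l rel \<Rightarrow> ('f, 'r, 'a) struct \<Rightarrow> ('l \<rightharpoonup> 'a) \<Rightarrow> bool" where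
  "is_tuple \<theta> \<CC> b \<longleftrightarrow> (\<exists>x\<in>Field \<theta>. dom b = underS \<theta> x) \<and> ran b \<subseteq> univ \<CC>"

definition order2_witness ::
  "('f, 'r, 'a) class_data \<Rightarrow> ('f, 'r, 'a) struct \<Rightarrow> 'l rel \<Rightarrow> 'o rel
     \<Rightarrow> ('l \<rightharpoonup> 'a) \<Rightarrow> ('o \<Rightarrow> 'l \<rightharpoonup> 'a) \<Rightarrow> ('o \<Rightarrow> ('f, 'r, 'a) struct) \<Rightarrow> bool" where
  "order2_witness K \<CC> \<theta> \<alpha> b bs Ns \<longleftrightarrow>
     is_tuple \<theta> \<CC> b \<and>
     (\<forall>i\<in>Field \<alpha>. is_tuple \<theta> \<CC> (bs i) \<and> Ns i \<preceq>\<^bsub>K\<^esub> \<CC> \<and>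
        |dom (bs i)| +c |univ (Ns i)| <o \<theta>) \<and>
     (\<forall>i\<in>Field \<alpha>. \<forall>j\<in>Field \<alpha>. (i, j) \<in> \<alpha> \<longleftrightarrow> bs j \<in> gtp K \<CC> b (univ (Ns i)))"

definition order2_property ::
  "('f, 'r, 'a) class_data \<Rightarrow> ('f, 'r, 'a) struct \<Rightarrow> 'l rel \<Rightarrow> 'o rel \<Rightarrow> bool" where
  "order2_property K \<CC> \<theta> \<alpha> \<longleftrightarrow> (\<exists>b bs Ns. order2_witness K \<CC> \<theta> \<alpha> b bs Ns)"

end

theory Submission
  imports Defs
begin

text \<open>
  Let \<open>b\<close> be a small subsequence of a realization of \<open>p\<close> and \<open>N0 \<preceq> N\<close> a small model such that the
  type of \<open>b\<close> over \<open>N0\<close> is omitted in \<open>M\<close>. By recursion on \<open>i < \<kappa>\<close>, the heir property gives an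
  automorphism that fixes \<open>b\<close> and everything chosen so far and moves \<open>N0\<close> to some \<open>N\<^sub>i \<preceq> M\<close>. No
  earlier \<open>b\<^sub>j\<close> realizes the type of \<open>b\<close> over \<open>N\<^sub>i\<close>, since otherwise it would realize the type of \<open>b\<close>
  over \<open>N0\<close>. Saturation then yields \<open>b\<^sub>i\<close> in \<open>M\<close> realizing the type of \<open>b\<close> over all \<open>N\<^sub>j\<close> with \<open>j \<le> i\<close>.

  Saturation speaks of single elements only. To realize the type of a small sequence \<open>b\<close> over a small
  \<open>M' \<preceq> M\<close>, one builds an increasing chain of small \<open>A \<preceq> M\<close> above \<open>M'\<close> together with automorphisms
  over \<open>M'\<close> that agree along the chain, each step capturing one more entry of \<open>b\<close> in the image of \<open>A\<close>;
  the inverse of the limit automorphism moves \<open>b\<close> into \<open>M\<close>.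
\<close>

section \<open>Structures and strong subsets\<close>

lemma Cinfinite_card_of: "infinite B \<Longrightarrow> Cinfinite |B|"
  by (simp add: cinfinite_def Field_card_of card_of_card_order_on)

text \<open>Outside \<open>A\<close> the values are the junk that \<open>is_struct\<close>
  prescribes, so that a substructure can be equal to an induced structure and not merely agree with
  it on \<open>A\<close>.\<close>

definition induced ::
  "('f, 'r) language \<Rightarrow> ('f, 'r, 'a) struct \<Rightarrow> 'a set \<Rightarrow> ('f, 'r, 'a) struct" where
  "induced L P A =
     \<lparr>univ = A,
      fint = (\<lambda>F xs. if F \<in> fsyms L \<and> xs \<in> args (far L F) A then fint P F xs else undefined),
      rint = (\<lambda>R xs. R \<in> rsyms L \<and> xs \<in> args (rar L R) A \<and> rint P R xs)\<rparr>"

lemma univ_induced [simp]: "univ (induced L P A) = A"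
  by (simp add: induced_def)

lemma args_mono: "A \<subseteq> B \<Longrightarrow> args n A \<subseteq> args n B"
  by (auto simp: args_def)

lemma is_struct_closed:
  "is_struct L P \<Longrightarrow> F \<in> fsyms L \<Longrightarrow> xs \<in> args (far L F) (univ P) \<Longrightarrow> fint P F xs \<in> univ P"
  by (simp add: is_struct_def)

lemma is_struct_induced:
  assumes "A \<noteq> {}"
    and "\<And>F xs. F \<in> fsyms L \<Longrightarrow> xs \<in> args (far L F) A \<Longrightarrow> fint P F xs \<in> A"
  shows "is_struct L (induced L P A)"
  using assms unfolding is_struct_def induced_def by auto

text \<open>\<open>is_struct\<close> leaves no freedom off the universe, and on it the
  interpretations are those of \<open>P\<close>. Hence substructures of a fixed \<open>P\<close> can
  be handled as subsets.\<close>

lemma substruct_eq_induced: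
  assumes "substruct L Q P"
  shows "Q = induced L P (univ Q)"
proof (rule struct.equality)
  have "fint Q F xs = fint (induced L P (univ Q)) F xs" for F xs
    using assms unfolding substruct_def is_struct_def induced_def by auto
  then show "fint Q = fint (induced L P (univ Q))" by blast
  have "rint Q R xs = rint (induced L P (univ Q)) R xs" for R xs
    using assms unfolding substruct_def is_struct_def induced_def
    by (cases "R \<in> rsyms L \<and> xs \<in> args (rar L R) (univ Q)") auto
  then show "rint Q = rint (induced L P (univ Q))" by blast
qed auto

lemma substruct_mono:
  assumes "substruct L Q P" "substruct L Q' P" "univ Q \<subseteq> univ Q'"
  shows "substruct L Q Q'"
proof -
  have "xs \<in> args n (univ Q')" if "xs \<in> args n (univ Q)" for n xs
    using that args_mono[OF assms(3)] by blast
  then show ?thesis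
    using assms unfolding substruct_def by simp
qed

lemma struct_iso_id: "is_struct L P \<Longrightarrow> struct_iso L id P P"
  unfolding struct_iso_def by simp

lemma map_in_args:
  "f ` A \<subseteq> B \<Longrightarrow> xs \<in> args n A \<Longrightarrow> map f xs \<in> args n B"
  by (auto simp: args_def)

lemma struct_iso_comp:
  assumes "struct_iso L f P Q" "struct_iso L g Q R"
  shows "struct_iso L (g \<circ> f) P R"
proof -
  have "f ` univ P \<subseteq> univ Q"
    using assms(1) by (auto simp: struct_iso_def bij_betw_def)
  then have "map f xs \<in> args n (univ Q)" if "xs \<in> args n (univ P)" for n xs
    using that map_in_args by blast
  then show ?thesis
    using assms bij_betw_trans unfolding struct_iso_def by fastforce
qed

text \<open>Each clause is the clause for \<open>f\<close> at the tuple of preimages; for function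
  symbols, injectivity of \<open>f\<close> then cancels \<open>f\<close>.\<close>

lemma struct_iso_inv:
  assumes "struct_iso L f P Q"
  shows "struct_iso L (inv_into (univ P) f) Q P"
proof -
  let ?h = "inv_into (univ P) f"
  have bij: "bij_betw f (univ P) (univ Q)" and P: "is_struct L P"
    using assms by (auto simp: struct_iso_def)
  have bij': "bij_betw ?h (univ Q) (univ P)"
    using bij by (rule bij_betw_inv_into)
  have arg: "map ?h ys \<in> args n (univ P)" if "ys \<in> args n (univ Q)" for n ys
    using that bij' by (auto simp: args_def bij_betw_def)
  have can: "map f (map ?h ys) = ys" if "ys \<in> args n (univ Q)" for n ys
    using that bij by (auto simp: args_def bij_betw_def f_inv_into_f intro!: map_idI)
  have "?h (fint Q F ys) = fint P F (map ?h ys)"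
    if "F \<in> fsyms L" "ys \<in> args (far L F) (univ Q)" for F ys
  proof -
    have "f (fint P F (map ?h ys)) = fint Q F (map f (map ?h ys))"
      using assms that(1) arg[OF that(2)] unfolding struct_iso_def by blast
    then have "f (fint P F (map ?h ys)) = fint Q F ys"
      using can[OF that(2)] by simp
    moreover have "fint P F (map ?h ys) \<in> univ P"
      using is_struct_closed[OF P] that arg by blast
    ultimately show ?thesis
      using bij by (metis bij_betw_inv_into_left)
  qed
  moreover have "rint Q R ys \<longleftrightarrow> rint P R (map ?h ys)"
    if "R \<in> rsyms L" "ys \<in> args (rar L R) (univ Q)" for R ys
  proof -
    have "rint P R (map ?h ys) \<longleftrightarrow> rint Q R (map f (map ?h ys))"
      using assms that(1) arg[OF that(2)] unfolding struct_iso_def by blast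
    then show ?thesis
      using can[OF that(2)] by simp
  qed
  ultimately show ?thesis
    using assms bij' unfolding struct_iso_def by simp
qed

text \<open>The image is closed under the functions because a tuple in it lifts entry by entry to a
  tuple in \<open>Q\<close>. This is what the isomorphism axiom needs for moving strong
  substructures along \<open>g\<close>.\<close>

lemma struct_iso_induced:
  assumes iso: "struct_iso L g P P'" and sub: "substruct L Q P"
  shows "struct_iso L g Q (induced L P' (g ` univ Q))"
proof -
  let ?Q' = "induced L P' (g ` univ Q)"
  have QP: "univ Q \<subseteq> univ P" and bij: "bij_betw g (univ P) (univ P')"
    using iso sub by (auto simp: struct_iso_def substruct_def)
  have arg: "xs \<in> args n (univ Q) \<Longrightarrow> xs \<in> args n (univ P)" for n xs
    using args_mono[OF QP] by blast
  have argm: "xs \<in> args n (univ Q) \<Longrightarrow> map g xs \<in> args n (g ` univ Q)" for n xs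
    by (auto simp: args_def)
  have f: "g (fint Q F xs) = fint P' F (map g xs)"
    if "F \<in> fsyms L" "xs \<in> args (far L F) (univ Q)" for F xs
    using that iso sub arg by (simp add: struct_iso_def substruct_def)
  have r: "rint Q R xs \<longleftrightarrow> rint P' R (map g xs)"
    if "R \<in> rsyms L" "xs \<in> args (rar L R) (univ Q)" for R xs
    using that iso sub arg by (simp add: struct_iso_def substruct_def)
  have clos: "fint P' F ys \<in> g ` univ Q"
    if F: "F \<in> fsyms L" and ys: "ys \<in> args (far L F) (g ` univ Q)" for F ys
  proof -
    have "ys \<in> lists (g ` univ Q)"
      using ys by (auto simp: args_def)
    then obtain xs where "set xs \<subseteq> univ Q" "ys = map g xs"
      by (auto simp: lists_image)
    moreover from this ys have "xs \<in> args (far L F) (univ Q)"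
      by (auto simp: args_def)
    ultimately show ?thesis
      using f[OF F, of xs] is_struct_closed[OF _ F, of Q xs] sub
      by (metis imageI substruct_def)
  qed
  have "is_struct L ?Q'"
    using sub clos by (intro is_struct_induced) (auto simp: substruct_def is_struct_def)
  moreover have "bij_betw g (univ Q) (univ ?Q')"
    using bij QP by (auto simp: bij_betw_def intro: inj_on_subset)
  ultimately show ?thesis
    using sub f r argm unfolding struct_iso_def substruct_def by (simp add: induced_def)
qed

text \<open>A strong substructure of \<open>P\<close> is recovered from its universe by
  \<open>induced\<close>, so chains and unions inside a fixed \<open>P\<close> become chains and
  unions of sets.\<close>

definition strong_sets :: "('f, 'r, 'a) class_data \<Rightarrow> ('f, 'r, 'a) struct \<Rightarrow> 'a set set" where
  "strong_sets K P = {univ Q | Q. Q \<preceq>\<^bsub>K\<^esub> P}"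

section \<open>Coherence and unions of chains\<close>

locale aec =
  fixes K :: "('f, 'r, 'a) class_data" and l :: "'l rel"
  assumes aec: "is_aec K l"
begin

abbreviation "L \<equiv> lang K"

lemma model_struct: "M \<in> models K \<Longrightarrow> is_struct L M"
  using aec[unfolded is_aec_def, THEN conjunct1] by blast

lemma strong_models: "M \<preceq>\<^bsub>K\<^esub> N \<Longrightarrow> M \<in> models K \<and> N \<in> models K"
  using aec[unfolded is_aec_def, THEN conjunct2, THEN conjunct1] by blast

lemma strong_substruct: "M \<preceq>\<^bsub>K\<^esub> N \<Longrightarrow> substruct L M N"
  using aec[unfolded is_aec_def, THEN conjunct2, THEN conjunct1] by blast

lemma strong_trans: "M \<preceq>\<^bsub>K\<^esub> N \<Longrightarrow> N \<preceq>\<^bsub>K\<^esub> P \<Longrightarrow> M \<preceq>\<^bsub>K\<^esub> P"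
  using aec[unfolded is_aec_def,
    THEN conjunct2, THEN conjunct2, THEN conjunct2, THEN conjunct1] by blast

lemma strong_iso:
  assumes "M \<preceq>\<^bsub>K\<^esub> N" "struct_iso L f N N'" "struct_iso L f M M'"
  shows "M' \<preceq>\<^bsub>K\<^esub> N'"
  using aec[unfolded is_aec_def,
    THEN conjunct2, THEN conjunct2, THEN conjunct2, THEN conjunct2, THEN conjunct2,
    THEN conjunct1]
    assms by metis

lemma strong_sub:
  assumes "M \<preceq>\<^bsub>K\<^esub> P" "N \<preceq>\<^bsub>K\<^esub> P" "substruct L M N"
  shows "M \<preceq>\<^bsub>K\<^esub> N"
  using aec[unfolded is_aec_def,
    THEN conjunct2, THEN conjunct2, THEN conjunct2, THEN conjunct2, THEN conjunct2,
    THEN conjunct2, THEN conjunct1]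
    assms by metis

lemma strong_univ: "M \<preceq>\<^bsub>K\<^esub> N \<Longrightarrow> univ M \<subseteq> univ N"
  using strong_substruct by (auto simp: substruct_def)

text \<open>Between two substructures of a common \<open>P\<close>, inclusion of universes already
  gives \<open>substruct\<close>, and the coherence axiom applies.\<close>

lemma strong_coherent:
  assumes "M \<preceq>\<^bsub>K\<^esub> P" "N \<preceq>\<^bsub>K\<^esub> P" "univ M \<subseteq> univ N"
  shows "M \<preceq>\<^bsub>K\<^esub> N"
  using strong_sub[OF assms(1,2)] substruct_mono[OF assms(1,2)[THEN strong_substruct] assms(3)] .

lemma chain_union:
  fixes r :: "'a rel"
  assumes "continuous_chain K r Ms" "\<And>i. i \<in> Field r \<Longrightarrow> Ms i \<preceq>\<^bsub>K\<^esub> N"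
  obtains U where "univ U = (\<Union>i\<in>Field r. univ (Ms i))" "U \<preceq>\<^bsub>K\<^esub> N"
proof -
  note aec[unfolded is_aec_def,
    THEN conjunct2, THEN conjunct2, THEN conjunct2, THEN conjunct2, THEN conjunct2,
    THEN conjunct2, THEN conjunct2, THEN conjunct1]
  with assms(1) obtain U where "univ U = (\<Union>i\<in>Field r. univ (Ms i))"
      "\<forall>N. (\<forall>i\<in>Field r. Ms i \<preceq>\<^bsub>K\<^esub> N) \<longrightarrow> U \<preceq>\<^bsub>K\<^esub> N"
    by metis
  then show thesis
    using that assms(2) by blast
qed

lemma model_nonempty: "M \<in> models K \<Longrightarrow> univ M \<noteq> {}"
  using model_struct by (simp add: is_struct_def)

lemma strong_setsD:
  assumes "A \<in> strong_sets K P"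
  shows "induced L P A \<preceq>\<^bsub>K\<^esub> P" "A \<subseteq> univ P" "A \<noteq> {}"
proof -
  obtain Q where Q: "Q \<preceq>\<^bsub>K\<^esub> P" "A = univ Q"
    using assms by (auto simp: strong_sets_def)
  then show "induced L P A \<preceq>\<^bsub>K\<^esub> P"
    using substruct_eq_induced strong_substruct by metis
  show "A \<subseteq> univ P"
    using Q strong_univ by simp
  show "A \<noteq> {}"
    using Q model_nonempty strong_models by simp
qed

lemma strong_setsI: "Q \<preceq>\<^bsub>K\<^esub> P \<Longrightarrow> univ Q \<in> strong_sets K P"
  by (auto simp: strong_sets_def)

lemma strong_sets_trans: "A \<in> strong_sets K P \<Longrightarrow> P \<preceq>\<^bsub>K\<^esub> P' \<Longrightarrow> A \<in> strong_sets K P'"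
  using strong_trans by (auto simp: strong_sets_def)

lemma strong_sets_coherent:
  "A \<in> strong_sets K P \<Longrightarrow> P' \<preceq>\<^bsub>K\<^esub> P \<Longrightarrow> A \<subseteq> univ P' \<Longrightarrow> A \<in> strong_sets K P'"
  by (auto simp: strong_sets_def intro: strong_coherent)

lemma strong_sets_image:
  assumes "A \<in> strong_sets K P" "struct_iso L g P P'"
  shows "g ` A \<in> strong_sets K P'"
proof -
  obtain Q where Q: "Q \<preceq>\<^bsub>K\<^esub> P" "A = univ Q"
    using assms by (auto simp: strong_sets_def)
  have "induced L P' (g ` univ Q) \<preceq>\<^bsub>K\<^esub> P'"
    using strong_iso[OF Q(1) assms(2)] struct_iso_induced[OF assms(2)] strong_substruct[OF Q(1)]
    by blast
  from strong_setsI[OF this] show ?thesis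
    using Q(2) by simp
qed

text \<open>Inside \<open>P\<close>, coherence turns inclusion into the strong relation, so the
  induced structures form a chain to which the chain axiom applies with bound
  \<open>P\<close>.\<close>

lemma strong_sets_continuous_union:
  fixes r :: "'a rel"
  assumes r: "Well_order r" "Field r \<noteq> {}" and P: "P \<in> models K"
    and B: "\<And>i. i \<in> Field r \<Longrightarrow> B i \<in> strong_sets K P"
    and mono: "\<And>i j. (i, j) \<in> r \<Longrightarrow> B i \<subseteq> B j"
    and lim: "\<And>i. i \<in> Field r \<Longrightarrow> underS r i \<noteq> {} \<Longrightarrow>
        \<forall>j\<in>underS r i. \<exists>k\<in>underS r i. j \<in> underS r k \<Longrightarrow> B i = (\<Union>j\<in>underS r i. B j)"
  shows "(\<Union>i\<in>Field r. B i) \<in> strong_sets K P"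
proof -
  define Ms where "Ms i = induced L P (B i)" for i
  have Ms: "Ms i \<preceq>\<^bsub>K\<^esub> P" if "i \<in> Field r" for i
    using strong_setsD(1)[OF B[OF that]] by (simp add: Ms_def)
  have "Ms i \<preceq>\<^bsub>K\<^esub> Ms j" if "(i, j) \<in> r" for i j
  proof -
    have "i \<in> Field r" "j \<in> Field r"
      using that by (auto simp: Field_def)
    then show ?thesis
      using strong_coherent[OF Ms Ms] mono[OF that] by (simp add: Ms_def)
  qed
  then have "continuous_chain K r Ms"
    unfolding continuous_chain_def using r lim strong_models[OF Ms] by (simp add: Ms_def)
  from chain_union[OF this Ms] obtain U
    where U: "univ U = (\<Union>i\<in>Field r. univ (Ms i))" "U \<preceq>\<^bsub>K\<^esub> P"
    by metis
  then show ?thesis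
    using strong_setsI[OF U(2)] by (simp add: U(1) Ms_def)
qed

text \<open>Continuity can be dropped: replacing the members at limit indices by the unions of the
  earlier ones makes the chain continuous without changing the union.\<close>

lemma strong_sets_union:
  fixes r :: "'a rel"
  assumes r: "Well_order r" "Field r \<noteq> {}" and P: "P \<in> models K"
    and A: "\<And>i. i \<in> Field r \<Longrightarrow> A i \<in> strong_sets K P"
    and mono: "\<And>i j. (i, j) \<in> r \<Longrightarrow> A i \<subseteq> A j"
  shows "(\<Union>i\<in>Field r. A i) \<in> strong_sets K P"
proof -
  define lim where "lim J \<longleftrightarrow> J \<noteq> {} \<and> (\<forall>j\<in>J. \<exists>k\<in>J. j \<in> underS r k)" for J
  define B where "B i = (if lim (underS r i) then \<Union>j\<in>underS r i. A j else A i)" for i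
  have refl: "Refl r" and tot: "Total r" and tr: "trans r" and anti: "antisym r"
    and wf: "wf (r - Id)"
    using r(1) by (simp_all add: order_on_defs well_order_on_def)
  \<comment> \<open>The two families interleave: \<open>B i\<close> lies in \<open>A i\<close>, and
    \<open>A i\<close> lies in \<open>B k\<close> for every \<open>k\<close> strictly above
    \<open>i\<close>. So \<open>B\<close> is increasing, and both have the same union over any set
    of indices without a last element.\<close>
  have BA: "B i \<subseteq> A i" for i
    using mono by (auto simp: B_def underS_def)
  have AB: "A i \<subseteq> B k" if "i \<in> underS r k" for i k
    using that mono[of i k] by (auto simp: B_def underS_def)
  have monoB: "B i \<subseteq> B j" if "(i, j) \<in> r" for i j
    using that BA AB[of i j] by (cases "i = j") (auto simp: underS_def)
  have union_lim: "(\<Union>j\<in>J. B j) = (\<Union>j\<in>J. A j)" if lJ: "lim J" for J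
  proof (intro antisym UN_least)
    fix j assume j: "j \<in> J"
    show "B j \<subseteq> (\<Union>j\<in>J. A j)"
      using BA[of j] j by blast
    obtain k where "k \<in> J" "j \<in> underS r k"
      using lJ j by (auto simp: lim_def)
    then show "A j \<subseteq> (\<Union>j\<in>J. B j)"
      using AB[of j k] by blast
  qed
  \<comment> \<open>Stated for an arbitrary initial segment \<open>J\<close>, since it is applied to
    the predecessors of a limit index during the induction and to the whole index set at the
    end.\<close>
  have key: "(\<Union>j\<in>J. A j) \<in> strong_sets K P"
    if J: "J \<subseteq> Field r" "lim J" and down: "\<And>i j. j \<in> J \<Longrightarrow> (i, j) \<in> r \<Longrightarrow> i \<in> J"
      and B: "\<And>j. j \<in> J \<Longrightarrow> B j \<in> strong_sets K P" for J
  proof -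
    let ?r = "Restr r J"
    have Fld: "Field ?r = J"
      using refl J(1) by (rule Refl_Field_Restr2)
    have under: "underS ?r j = underS r j" if "j \<in> J" for j
      using that down by (auto simp: underS_def)
    have "(\<Union>j\<in>Field ?r. B j) \<in> strong_sets K P"
    proof (rule strong_sets_continuous_union[OF _ _ P])
      show "Well_order ?r"
        using r(1) by (rule Well_order_Restr)
      show "Field ?r \<noteq> {}"
        using J(2) Fld by (simp add: lim_def)
      show "B i \<in> strong_sets K P" if "i \<in> Field ?r" for i
        using that B Fld by simp
      show "B i \<subseteq> B j" if "(i, j) \<in> ?r" for i j
        using that monoB by simp
      show "B i = (\<Union>j\<in>underS ?r i. B j)"
        if i: "i \<in> Field ?r" and ne: "underS ?r i \<noteq> {}"
          and lm: "\<forall>j\<in>underS ?r i. \<exists>k\<in>underS ?r i. j \<in> underS ?r k" for i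
      proof -
        have iJ: "i \<in> J"
          using i Fld by simp
        have "underS r i \<subseteq> J"
          using down iJ by (auto simp: underS_def)
        then have "lim (underS r i)"
          using ne lm unfolding lim_def under[OF iJ] using under by blast
        then show ?thesis
          using union_lim[of "underS r i"] under[OF iJ] by (simp add: B_def)
      qed
    qed
    then show ?thesis
      using union_lim[OF J(2)] Fld by simp
  qed
  have B: "B i \<in> strong_sets K P" if "i \<in> Field r" for i
    using wf that
  proof (induction i rule: wf_induct_rule)
    case (less i)
    show ?case
    proof (cases "lim (underS r i)")
      case True
      have "(\<Union>j\<in>underS r i. A j) \<in> strong_sets K P"
      proof (rule key[OF _ True])
        show "underS r i \<subseteq> Field r"
          by (auto simp: underS_def Field_def)
        show "k \<in> underS r i" if "j \<in> underS r i" "(k, j) \<in> r" for j k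
          using that tr anti by (auto simp: underS_def dest: transD antisymD)
        show "B j \<in> strong_sets K P" if "j \<in> underS r i" for j
          using that less by (auto simp: underS_def Field_def)
      qed
      then show ?thesis
        using True by (simp add: B_def)
    next
      case False
      then show ?thesis
        using A less by (simp add: B_def)
    qed
  qed
  show ?thesis
  proof (cases "lim (Field r)")
    case True
    then show ?thesis
      using key[of "Field r"] B by (auto simp: Field_def)
  next
    case False
    \<comment> \<open>Being nonempty and not a limit, the index set has a last element
      \<open>m\<close>, and the union is \<open>A m\<close>.\<close>
    then obtain m where m: "m \<in> Field r" "\<And>k. k \<in> Field r \<Longrightarrow> m \<notin> underS r k"
      using r(2) by (auto simp: lim_def)
    have "(i, m) \<in> r" if "i \<in> Field r" for i
      using m(1) m(2)[OF that] that tot refl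
      by (cases "i = m") (auto simp: underS_def total_on_def refl_on_def)
    then have "(\<Union>i\<in>Field r. A i) = A m"
      using mono m(1) by blast
    then show ?thesis
      using A[OF m(1)] by simp
  qed
qed

section \<open>The downward Loewenheim-Skolem property\<close>

lemma LS: "LS_property K l"
  using aec by (simp add: is_aec_def is_LS_number_def)

lemma Card_order_l: "Card_order l" and natLeq_l: "natLeq \<le>o l"
  using LS by (auto simp: LS_property_def)

text \<open>As \<open>B\<close> is infinite and bounds both \<open>X\<close> and \<open>l\<close>,
  it bounds their cardinal sum. With the bound \<open>|B|\<close> in this form, the same
  \<open>B\<close> can serve at all stages of a construction.\<close>

lemma downward_LS:
  assumes "M \<in> models K" "X \<subseteq> univ M" "|X| \<le>o |B|" "l \<le>o |B|"
  obtains Q where "Q \<preceq>\<^bsub>K\<^esub> M" "X \<subseteq> univ Q" "|univ Q| \<le>o |B|"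
proof -
  obtain Q where Q: "Q \<preceq>\<^bsub>K\<^esub> M" "X \<subseteq> univ Q" "|univ Q| \<le>o |X| +c l"
    using LS assms(1,2) unfolding LS_property_def by blast
  have "natLeq \<le>o |B|"
    using natLeq_l assms(4) by (rule ordLeq_transitive)
  then have "infinite B"
    using infinite_iff_natLeq_ordLeq by blast
  then have "Cinfinite |B|"
    by (rule Cinfinite_card_of)
  then have "|X| +c l \<le>o |B|"
    using assms(3,4) Card_order_l by (intro csum_cinfinite_bound) (auto simp: card_of_Card_order)
  then show thesis
    using that Q ordLeq_transitive by blast
qed

end

section \<open>Gluing automorphisms and realizing types\<close>

locale monster_aec = aec K l for K :: "('f, 'r, 'a) class_data" and l :: "'l rel" +
  fixes \<kappa> :: "'k rel" and \<mu> :: "'m rel" and \<CC> :: "('f, 'r, 'a) struct"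
  assumes Card_order_kappa: "Card_order \<kappa>" and l_less_kappa: "l <o \<kappa>"
    and kappa_le_mu: "\<kappa> \<le>o \<mu>" and monster: "monster K \<mu> \<CC>"
begin

abbreviation "aut g \<equiv> struct_iso L g \<CC> \<CC>"

lemma monster_model: "\<CC> \<in> models K"
  using monster by (simp add: monster_def)

lemma aut_extends:
  assumes "Q \<preceq>\<^bsub>K\<^esub> \<CC>" "Q' \<preceq>\<^bsub>K\<^esub> \<CC>" "|univ Q| <o \<mu>" "struct_iso L f Q Q'"
  obtains g where "aut g" "\<And>x. x \<in> univ Q \<Longrightarrow> g x = f x"
  using assms monster unfolding monster_def by metis

lemma aut_id: "aut id"
  using struct_iso_id model_struct monster_model by blast

lemma aut_comp: "aut f \<Longrightarrow> aut g \<Longrightarrow> aut (g \<circ> f)"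
  by (rule struct_iso_comp)

lemma aut_in: "aut g \<Longrightarrow> x \<in> univ \<CC> \<Longrightarrow> g x \<in> univ \<CC>"
  by (auto simp: struct_iso_def bij_betw_def)

lemma aut_inverse:
  assumes "aut g"
  obtains h where "aut h" "\<And>x. x \<in> univ \<CC> \<Longrightarrow> h (g x) = x" "\<And>x. x \<in> univ \<CC> \<Longrightarrow> g (h x) = x"
proof
  have bij: "bij_betw g (univ \<CC>) (univ \<CC>)"
    using assms by (simp add: struct_iso_def)
  show "aut (inv_into (univ \<CC>) g)"
    using assms by (rule struct_iso_inv)
  show "inv_into (univ \<CC>) g (g x) = x" if "x \<in> univ \<CC>" for x
    using bij that by (rule bij_betw_inv_into_left)
  show "g (inv_into (univ \<CC>) g x) = x" if "x \<in> univ \<CC>" for x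
    using bij that by (rule bij_betw_inv_into_right)
qed

lemma less_kappa_less_mu: "r <o \<kappa> \<Longrightarrow> r <o \<mu>"
  using kappa_le_mu by (rule ordLess_ordLeq_trans[rotated])

lemma kappa_infinite: "\<not> finite (Field \<kappa>)"
proof -
  have "natLeq \<le>o \<kappa>"
    using ordLeq_transitive[OF natLeq_l ordLess_imp_ordLeq[OF l_less_kappa]] .
  then have "natLeq \<le>o |Field \<kappa>|"
    using card_of_Field_ordIso[OF Card_order_kappa] ordIso_symmetric ordLeq_ordIso_trans by blast
  then show ?thesis
    using infinite_iff_natLeq_ordLeq by blast
qed

lemma Plus_less_kappa: "|A| <o \<kappa> \<Longrightarrow> |B| <o \<kappa> \<Longrightarrow> |A <+> B| <o \<kappa>"
  using card_of_Plus_ordLess_infinite_Field kappa_infinite Card_order_kappa by blast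

lemma Un_less_kappa: "|A| <o \<kappa> \<Longrightarrow> |B| <o \<kappa> \<Longrightarrow> |A \<union> B| <o \<kappa>"
  using card_of_Un_ordLess_infinite_Field kappa_infinite Card_order_kappa by blast

text \<open>Uniform bounds by the cardinality of a set \<open>B\<close>, instead of bounds by \<open>\<kappa>\<close>, keep unions of
  fewer than \<open>\<kappa>\<close> models below \<open>\<kappa>\<close> when \<open>\<kappa>\<close> is singular.\<close>

lemma common_bound:
  fixes X :: "'x set" and Y :: "'y set"
  assumes "|X| <o \<kappa>" "|Y| <o \<kappa>"
  obtains B :: "('x + 'y + 'l) set"
  where "|B| <o \<kappa>" "|X| \<le>o |B|" "|Y| \<le>o |B|" "l \<le>o |B|" "infinite B"
proof
  \<comment> \<open>The summand \<open>Field l\<close> makes the set infinite and large enough for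
    \<open>downward_LS\<close>.\<close>
  let ?B = "X <+> (Y <+> Field l)"
  have l: "|Field l| =o l"
    using Card_order_l by (rule card_of_Field_ordIso)
  then have "|Field l| <o \<kappa>"
    using l_less_kappa ordIso_ordLess_trans by blast
  then show "|?B| <o \<kappa>"
    using assms by (intro Plus_less_kappa)
  show "|X| \<le>o |?B|"
    by (rule card_of_Plus1)
  show "|Y| \<le>o |?B|"
    by (rule ordLeq_transitive[OF card_of_Plus1 card_of_Plus2])
  have "|Field l| \<le>o |?B|"
    by (rule ordLeq_transitive[OF card_of_Plus2 card_of_Plus2])
  then show lB: "l \<le>o |?B|"
    using l ordIso_symmetric ordIso_ordLeq_trans by blast
  show "infinite ?B"
    using ordLeq_transitive[OF natLeq_l lB] infinite_iff_natLeq_ordLeq by blast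
qed

lemma small_LS:
  assumes "M \<in> models K" "X \<subseteq> univ M" "|X| <o \<kappa>"
  obtains Q where "Q \<preceq>\<^bsub>K\<^esub> M" "X \<subseteq> univ Q" "|univ Q| <o \<kappa>"
proof -
  obtain B :: "('a + 'a + 'l) set" where B: "|B| <o \<kappa>" "|X| \<le>o |B|" "l \<le>o |B|"
    using common_bound[OF assms(3,3)] by metis
  obtain Q where "Q \<preceq>\<^bsub>K\<^esub> M" "X \<subseteq> univ Q" "|univ Q| \<le>o |B|"
    using downward_LS[OF assms(1,2) B(2,3)] .
  then show thesis
    using that B(1) ordLeq_ordLess_trans by blast
qed

text \<open>The restrictions of the \<open>g i\<close> to the \<open>A i\<close> unite to an
  isomorphism between two strong subsets of \<CC>. Their union is smaller than \<mu>, so homogeneity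
  of the monster extends this isomorphism to an automorphism.\<close>

lemma glue_automorphisms:
  fixes r :: "'a rel"
  assumes r: "Well_order r" "Field r \<noteq> {}"
    and A: "\<And>i. i \<in> Field r \<Longrightarrow> A i \<in> strong_sets K \<CC>"
    and g: "\<And>i. i \<in> Field r \<Longrightarrow> aut (g i)"
    and mono: "\<And>i j. (i, j) \<in> r \<Longrightarrow> A i \<subseteq> A j"
    and agree: "\<And>i j x. (i, j) \<in> r \<Longrightarrow> x \<in> A i \<Longrightarrow> g j x = g i x"
    and small: "|\<Union>i\<in>Field r. A i| <o \<mu>"
  obtains h where "aut h" "\<And>i x. i \<in> Field r \<Longrightarrow> x \<in> A i \<Longrightarrow> h x = g i x"
proof -
  define U where "U = (\<Union>i\<in>Field r. A i)"
  define V where "V = (\<Union>i\<in>Field r. g i ` A i)"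
  \<comment> \<open>Any index whose set contains \<open>x\<close> gives the same value, because
    indices are comparable and the automorphisms agree along the chain.\<close>
  define f where "f x = g (SOME i. i \<in> Field r \<and> x \<in> A i) x" for x
  have tot: "(i, j) \<in> r \<or> (j, i) \<in> r" if "i \<in> Field r" "j \<in> Field r" for i j
    using r(1) that by (cases "i = j") (auto simp: order_on_defs well_order_on_def total_on_def refl_on_def)
  have f: "f x = g i x" if "i \<in> Field r" "x \<in> A i" for i x
  proof -
    let ?j = "SOME i. i \<in> Field r \<and> x \<in> A i"
    have j: "?j \<in> Field r \<and> x \<in> A ?j"
      using that by (metis (mono_tags, lifting) someI)
    then show ?thesis
      using tot[of i ?j] that agree[of i ?j x] agree[of ?j i x] by (auto simp: f_def)
  qed
  have U: "U \<in> strong_sets K \<CC>"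
    unfolding U_def by (rule strong_sets_union[OF r monster_model A mono])
  have V: "V \<in> strong_sets K \<CC>"
    unfolding V_def
  proof (rule strong_sets_union[OF r monster_model])
    show "g i ` A i \<in> strong_sets K \<CC>" if "i \<in> Field r" for i
      using strong_sets_image A g that by blast
    show "g i ` A i \<subseteq> g j ` A j" if "(i, j) \<in> r" for i j
    proof
      fix y assume "y \<in> g i ` A i"
      then obtain x where "x \<in> A i" "y = g i x" by blast
      then show "y \<in> g j ` A j"
        using mono[OF that] agree[OF that, of x] by (metis image_eqI subsetD)
    qed
  qed
  \<comment> \<open>Symbols are finitary: every tuple from \<open>U\<close> lies in a single
    \<open>A j\<close>, so preservation of the structure can be read off from one
    \<open>g j\<close>.\<close>
  have list: "\<exists>j\<in>Field r. set xs \<subseteq> A j" if "set xs \<subseteq> U" for xs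
    using that
  proof (induction xs)
    case Nil
    then show ?case using r(2) by auto
  next
    case (Cons x xs)
    then obtain j where j: "j \<in> Field r" "set xs \<subseteq> A j" by auto
    obtain i where i: "i \<in> Field r" "x \<in> A i"
      using Cons.prems by (auto simp: U_def)
    show ?case
      using tot[OF i(1) j(1)] i j mono[of i j] mono[of j i] by fastforce
  qed
  have fU: "f ` U = V"
    unfolding U_def V_def image_UN using f by (intro SUP_cong HOL.refl image_cong) auto
  have "struct_iso L f (induced L \<CC> U) (induced L \<CC> V)"
    unfolding struct_iso_def
  proof (intro conjI ballI)
    show "is_struct L (induced L \<CC> U)" "is_struct L (induced L \<CC> V)"
      using strong_setsD(1)[OF U] strong_setsD(1)[OF V] strong_models model_struct by blast+
    have "inj_on f U"
    proof (rule inj_onI)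
      fix x y assume xy: "x \<in> U" "y \<in> U" "f x = f y"
      then obtain j where j: "j \<in> Field r" "x \<in> A j" "y \<in> A j"
        using list[of "[x, y]"] by auto
      then have "x \<in> univ \<CC>" "y \<in> univ \<CC>"
        using strong_setsD(2)[OF A] by auto
      then show "x = y"
        using xy(3) f[OF j(1,2)] f[OF j(1,3)] g[OF j(1)]
        by (auto simp: struct_iso_def bij_betw_def inj_on_def)
    qed
    then show "bij_betw f (univ (induced L \<CC> U)) (univ (induced L \<CC> V))"
      using fU by (simp add: bij_betw_def)
  next
    fix F xs assume F: "F \<in> fsyms L" and "xs \<in> args (far L F) (univ (induced L \<CC> U))"
    then have xs: "xs \<in> args (far L F) U" by simp
    then obtain j where j: "j \<in> Field r" "set xs \<subseteq> A j"
      using list[of xs] by (auto simp: args_def)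
    have xsj: "xs \<in> args (far L F) (A j)"
      using xs j by (auto simp: args_def)
    have xsC: "xs \<in> args (far L F) (univ \<CC>)"
      using xsj args_mono[OF strong_setsD(2)[OF A[OF j(1)]]] by blast
    \<comment> \<open>The function value also has to lie in \<open>A j\<close>, where
      \<open>f\<close> agrees with \<open>g j\<close>.\<close>
    have "is_struct L (induced L \<CC> (A j))"
      using strong_setsD(1)[OF A[OF j(1)]] strong_models model_struct by blast
    from is_struct_closed[OF this F] have "fint \<CC> F xs \<in> A j"
      using xsj F by (simp add: induced_def)
    then have "f (fint \<CC> F xs) = fint \<CC> F (map (g j) xs)"
      using f[OF j(1)] g[OF j(1)] F xsC by (simp add: struct_iso_def)
    moreover have "map (g j) xs = map f xs"
      using f[OF j(1)] j(2) by auto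
    moreover have "map f xs \<in> args (far L F) V"
      using xs fU by (auto simp: args_def)
    ultimately show "f (fint (induced L \<CC> U) F xs) = fint (induced L \<CC> V) F (map f xs)"
      using xs F by (simp add: induced_def)
  next
    fix R xs assume R: "R \<in> rsyms L" and "xs \<in> args (rar L R) (univ (induced L \<CC> U))"
    then have xs: "xs \<in> args (rar L R) U" by simp
    then obtain j where j: "j \<in> Field r" "set xs \<subseteq> A j"
      using list[of xs] by (auto simp: args_def)
    have "xs \<in> args (rar L R) (A j)"
      using xs j by (auto simp: args_def)
    then have "xs \<in> args (rar L R) (univ \<CC>)"
      using args_mono[OF strong_setsD(2)[OF A[OF j(1)]]] by blast
    then have "rint \<CC> R xs \<longleftrightarrow> rint \<CC> R (map (g j) xs)"
      using g[OF j(1)] R by (simp add: struct_iso_def)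
    moreover have "map (g j) xs = map f xs"
      using f[OF j(1)] j(2) by auto
    moreover have "map f xs \<in> args (rar L R) V"
      using xs fU by (auto simp: args_def)
    ultimately show "rint (induced L \<CC> U) R xs \<longleftrightarrow> rint (induced L \<CC> V) R (map f xs)"
      using xs R by (simp add: induced_def)
  qed
  then obtain h where "aut h" "\<And>x. x \<in> U \<Longrightarrow> h x = f x"
    using aut_extends[OF strong_setsD(1)[OF U] strong_setsD(1)[OF V]] small
    by (metis U_def univ_induced)
  then show thesis
    using that f by (force simp: U_def)
qed

section \<open>Realizing types of small sequences in a saturated model\<close>

definition partial_aut ::
  "('f, 'r, 'a) struct \<Rightarrow> 'a set \<Rightarrow> 'x rel \<Rightarrow> 'a set \<times> ('a \<Rightarrow> 'a) \<Rightarrow> bool" where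
  "partial_aut M X \<theta> = (\<lambda>(A, g). A \<in> strong_sets K M \<and> aut g \<and> X \<subseteq> A \<and> (\<forall>x\<in>X. g x = x) \<and> |A| \<le>o \<theta>)"

text \<open>Each approximation carries an automorphism of all of \<CC>, but only its values on the
  first component are binding; later stages may change it elsewhere.\<close>

definition extends :: "'a set \<times> ('a \<Rightarrow> 'a) \<Rightarrow> 'a set \<times> ('a \<Rightarrow> 'a) \<Rightarrow> bool" where
  "extends = (\<lambda>(A, g) (A', g'). A \<subseteq> A' \<and> (\<forall>x\<in>A. g' x = g x))"

lemma extends_refl: "extends p p"
  by (auto simp: extends_def)

lemma extends_trans: "extends p q \<Longrightarrow> extends q s \<Longrightarrow> extends p s"
  by (fastforce simp: extends_def)

text \<open>Let \<open>y\<close> be the preimage of \<open>x\<close> under \<open>h\<close>.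
  Saturation for single elements realizes the type of \<open>y\<close> over \<open>U\<close> by some
  \<open>k y\<close> in \<open>M\<close>, where \<open>k\<close> fixes \<open>U\<close>. Then
  \<open>h\<close> after the inverse of \<open>k\<close> agrees with \<open>h\<close> on
  \<open>U\<close> and sends \<open>k y\<close> to \<open>x\<close>.\<close>

lemma partial_aut_one_step:
  assumes M: "M \<preceq>\<^bsub>K\<^esub> \<CC>" "saturated K \<CC> \<kappa> M"
    and B: "|B| <o \<kappa>" "l \<le>o |B|" "infinite B"
    and p: "partial_aut M X |B| p" and x: "x \<in> univ \<CC>"
  obtains A g where "partial_aut M X |B| (A, g)" "extends p (A, g)" "x \<in> g ` A"
proof -
  obtain U h where ph: "p = (U, h)"
    by (cases p)
  have U: "U \<in> strong_sets K M" "aut h" "X \<subseteq> U" "\<And>x. x \<in> X \<Longrightarrow> h x = x" "|U| \<le>o |B|"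
    using p by (auto simp: ph partial_aut_def)
  have UC: "U \<subseteq> univ \<CC>"
    using strong_setsD(2)[OF U(1)] strong_univ[OF M(1)] by blast
  obtain h' where h': "aut h'" "\<And>x. x \<in> univ \<CC> \<Longrightarrow> h (h' x) = x"
    using aut_inverse[OF U(2)] by metis
  define y where "y = h' x"
  have y: "y \<in> univ \<CC>" "h y = x"
    using h' x aut_in by (auto simp: y_def)
  let ?a = "[() \<mapsto> y]"
  have "gtp K \<CC> ?a U \<in> gS K \<CC> {()} (induced L M U)"
    using y(1) by (auto simp: gS_def intro!: exI[of _ ?a])
  moreover have "|univ (induced L M U)| <o \<kappa>"
    using U(5) B(1) ordLeq_ordLess_trans by auto
  ultimately obtain c where c: "c \<in> gtp K \<CC> ?a U" "ran c \<subseteq> univ M"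
    using M(2) strong_setsD(1)[OF U(1)] unfolding saturated_def by blast
  obtain k where k: "aut k" "\<And>u. u \<in> U \<Longrightarrow> k u = u" "c = map_option k \<circ> ?a"
    using c(1) by (auto simp: gtp_def)
  have ky: "k y \<in> univ M"
    using c(2) by (auto simp: k(3) ran_def)
  obtain k' where k': "aut k'" "\<And>x. x \<in> univ \<CC> \<Longrightarrow> k' (k x) = x"
    using aut_inverse[OF k(1)] by metis
  \<comment> \<open>The set is enlarged to a strong subset of \<open>M\<close> containing
    \<open>k y\<close>, still of size at most \<open>|B|\<close>.\<close>
  have "|{k y}| \<le>o |B|"
    using B(3) by (intro card_of_singl_ordLeq) auto
  then have "|insert (k y) U| \<le>o |B|"
    using Un_Cinfinite_bound[of "{k y}" "|B|" U] U(5) Cinfinite_card_of[OF B(3)] by simp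
  then obtain Q where Q: "Q \<preceq>\<^bsub>K\<^esub> M" "insert (k y) U \<subseteq> univ Q" "|univ Q| \<le>o |B|"
    using downward_LS[of M "insert (k y) U" B] ky strong_setsD(2)[OF U(1)] strong_models[OF M(1)] B(2)
    by blast
  let ?g = "h \<circ> k'"
  have gU: "?g u = h u" if "u \<in> U" for u
    using k'(2)[of u] k(2)[OF that] UC that by auto
  show thesis
  proof
    show "partial_aut M X |B| (univ Q, ?g)"
      using strong_setsI[OF Q(1)] aut_comp[OF k'(1) U(2)] Q(2,3) U(3,4) gU
      by (auto simp: partial_aut_def)
    show "extends p (univ Q, ?g)"
      using Q(2) gU by (auto simp: extends_def ph)
    show "x \<in> ?g ` univ Q"
      using Q(2) k'(2)[OF y(1)] y(2) by (intro image_eqI[of _ _ "k y"]) auto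
  qed
qed

text \<open>Gluing supplies the automorphism. The bound \<open>|B|\<close> survives because at most
  \<open>|B|\<close> sets of size at most \<open>|B|\<close> are united.\<close>

lemma partial_aut_union:
  fixes r :: "'a rel"
  assumes r: "Well_order r" "J \<subseteq> Field r" and M: "M \<preceq>\<^bsub>K\<^esub> \<CC>"
    and X: "X \<in> strong_sets K M" "|X| \<le>o |B|"
    and B: "|B| <o \<kappa>" "infinite B" "|J| \<le>o |B|"
    and G: "\<And>i. i \<in> J \<Longrightarrow> partial_aut M X |B| (G i)"
    and ext: "\<And>i j. i \<in> J \<Longrightarrow> j \<in> J \<Longrightarrow> (i, j) \<in> r \<Longrightarrow> extends (G i) (G j)"
  obtains q where "partial_aut M X |B| q" "\<And>i. i \<in> J \<Longrightarrow> extends (G i) q"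
proof (cases "J = {}")
  case True
  \<comment> \<open>This is the starting point when a stage has no predecessors.\<close>
  have "partial_aut M X |B| (X, id)"
    using X aut_id by (simp add: partial_aut_def)
  then show ?thesis
    using that True by blast
next
  case False
  let ?r = "Restr r J"
  define A where "A i = fst (G i)" for i
  define g where "g i = snd (G i)" for i
  define U where "U = (\<Union>i\<in>J. A i)"
  have G': "A i \<in> strong_sets K M" "aut (g i)" "X \<subseteq> A i" "\<And>x. x \<in> X \<Longrightarrow> g i x = x" "|A i| \<le>o |B|"
    if "i \<in> J" for i
    using G[OF that] by (auto simp: partial_aut_def A_def g_def split: prod.splits)
  have ext': "A i \<subseteq> A j" "\<And>x. x \<in> A i \<Longrightarrow> g j x = g i x" if "(i, j) \<in> ?r" for i j
    using that ext[of i j] by (auto simp: extends_def A_def g_def split: prod.splits)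
  have wo: "Well_order ?r"
    using r(1) by (rule Well_order_Restr)
  have Fld: "Field ?r = J"
    using r by (intro Refl_Field_Restr2) (auto simp: order_on_defs well_order_on_def)
  have ne: "Field ?r \<noteq> {}"
    using False Fld by simp
  have UB: "|U| \<le>o |B|"
    unfolding U_def using G'(5) by (intro card_of_UNION_ordLeq_infinite[OF B(2,3)] ballI)
  have "(\<Union>i\<in>Field ?r. A i) \<in> strong_sets K M"
  proof (rule strong_sets_union[OF wo ne])
    show "M \<in> models K"
      using strong_models[OF M] by simp
  qed (use G'(1) ext'(1) Fld in auto)
  then have UM: "U \<in> strong_sets K M"
    using Fld by (simp add: U_def)
  have "|U| <o \<mu>"
    using UB B(1) ordLeq_ordLess_trans less_kappa_less_mu by blast
  then have small: "|\<Union>i\<in>Field ?r. A i| <o \<mu>"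
    using Fld by (simp add: U_def)
  obtain h where h: "aut h" "\<And>i x. i \<in> J \<Longrightarrow> x \<in> A i \<Longrightarrow> h x = g i x"
  proof (rule glue_automorphisms[OF wo ne _ _ _ _ small, of g])
    show "A i \<in> strong_sets K \<CC>" if "i \<in> Field ?r" for i
      using strong_sets_trans[OF G'(1) M] that Fld by simp
    show "aut (g i)" if "i \<in> Field ?r" for i
      using G'(2) that Fld by simp
  qed (use ext' Fld in auto)
  show ?thesis
  proof (rule that)
    obtain i where i: "i \<in> J"
      using False by blast
    have "X \<subseteq> U"
      using G'(3)[OF i] i by (auto simp: U_def)
    moreover have "h x = x" if "x \<in> X" for x
      using h(2)[OF i, of x] G'(3,4)[OF i] that by auto
    ultimately show "partial_aut M X |B| (U, h)"
      using UM h(1) UB by (simp add: partial_aut_def)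
    show "extends (G i) (U, h)" if "i \<in> J" for i
      using that h(2) by (auto simp: extends_def U_def A_def g_def split: prod.splits)
  qed
qed

text \<open>The stages are the entries of \<open>b\<close> themselves, well-ordered by
  \<open>|ran b|\<close>: they have type \<open>'a\<close>, which is the type of the indices in the
  chain axiom.\<close>

lemma saturated_realizes:
  fixes b :: "'i \<rightharpoonup> 'a"
  assumes M: "M \<preceq>\<^bsub>K\<^esub> \<CC>" "saturated K \<CC> \<kappa> M"
    and M': "M' \<preceq>\<^bsub>K\<^esub> M" "|univ M'| <o \<kappa>"
    and b: "ran b \<subseteq> univ \<CC>" "|ran b| <o \<kappa>"
  obtains c where "c \<in> gtp K \<CC> b (univ M')" "ran c \<subseteq> univ M"
proof -
  let ?R = "ran b" and ?r = "|ran b|" and ?X = "univ M'"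
  obtain B :: "('a + 'a + 'l) set"
    where B: "|B| <o \<kappa>" "|?X| \<le>o |B|" "|?R| \<le>o |B|" "l \<le>o |B|" "infinite B"
    using common_bound[OF M'(2) b(2)] .
  have X: "?X \<in> strong_sets K M"
    using M'(1) by (rule strong_setsI)
  have wo: "Well_order ?r"
    by (rule card_of_Well_order)
  have Fld: "Field ?r = ?R"
    by (rule Field_card_of)
  have wf: "wf (?r - Id)"
    using wo by (simp add: well_order_on_def)
  \<comment> \<open>Stage \<open>x\<close> puts \<open>x\<close> in the image and extends all
    earlier stages. The guard is there because the recursion runs over the whole type; outside
    \<open>?R\<close> any value will do.\<close>
  define P where "P F x q \<longleftrightarrow> (x \<in> ?R \<longrightarrow> partial_aut M ?X |B| q \<and> x \<in> snd q ` fst q \<and>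
      (\<forall>y. (y, x) \<in> ?r - Id \<longrightarrow> extends (F y) q))"
    for F :: "'a \<Rightarrow> 'a set \<times> ('a \<Rightarrow> 'a)" and x q
  \<comment> \<open>Needed twice: for the stages before a given \<open>x\<close>, and for all of
    \<open>?R\<close> at the end.\<close>
  have union: "\<exists>q. partial_aut M ?X |B| q \<and> (\<forall>y\<in>J. extends (F y) q)"
    if J: "J \<subseteq> ?R" and F: "\<And>y. y \<in> J \<Longrightarrow> P F y (F y)" for J F
  proof -
    have "|J| \<le>o |B|"
      using card_of_mono1[OF J] B(3) by (rule ordLeq_transitive)
    moreover have pa: "partial_aut M ?X |B| (F y)" if "y \<in> J" for y
      using F[OF that] J that by (auto simp: P_def)
    moreover have "extends (F y) (F z)" if "y \<in> J" "z \<in> J" "(y, z) \<in> ?r" for y z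
      using F[OF that(2)] J that by (cases "y = z") (auto simp: P_def extends_refl)
    moreover have "J \<subseteq> Field ?r"
      using J Fld by simp
    ultimately obtain q where "partial_aut M ?X |B| q" "\<And>y. y \<in> J \<Longrightarrow> extends (F y) q"
      using partial_aut_union[OF wo _ M(1) X B(2) B(1,5), of J F] by blast
    then show ?thesis
      by blast
  qed
  have "\<exists>F. \<forall>x. P F x (F x)"
  proof (rule dependent_wf_choice[OF wf])
    show "P F x q = P G x q" if "\<And>z. (z, x) \<in> ?r - Id \<Longrightarrow> F z = G z" for F G x q
      using that by (auto simp: P_def)
    show "\<exists>q. P F x q" if IH: "\<And>y. (y, x) \<in> ?r - Id \<Longrightarrow> P F y (F y)" for F x
    proof (cases "x \<in> ?R")
      case True
      have "underS ?r x \<subseteq> Field ?r"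
        by (auto simp: underS_def Field_def)
      moreover have "P F y (F y)" if "y \<in> underS ?r x" for y
        using IH[of y] that by (simp add: underS_def)
      ultimately obtain q
        where q: "partial_aut M ?X |B| q" "\<And>y. y \<in> underS ?r x \<Longrightarrow> extends (F y) q"
        using union[of "underS ?r x" F] Fld by auto
      obtain A g where "partial_aut M ?X |B| (A, g)" "extends q (A, g)" "x \<in> g ` A"
        using partial_aut_one_step[OF M B(1,4,5) q(1)] True b(1) by blast
      moreover from this have "extends (F y) (A, g)" if "(y, x) \<in> ?r - Id" for y
        using extends_trans[OF q(2)] that by (simp add: underS_def)
      ultimately have "P F x (A, g)"
        by (simp add: P_def)
      then show ?thesis ..
    qed (simp add: P_def)
  qed
  then obtain F where F: "\<And>x. P F x (F x)"
    by blast
  then obtain q where q: "partial_aut M ?X |B| q" "\<And>y. y \<in> ?R \<Longrightarrow> extends (F y) q"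
    using union[of ?R F] by blast
  obtain U h where qU: "q = (U, h)"
    by (cases q)
  have U: "U \<in> strong_sets K M" "aut h" "?X \<subseteq> U" "\<And>x. x \<in> ?X \<Longrightarrow> h x = x"
    using q(1) by (auto simp: qU partial_aut_def)
  have UM: "U \<subseteq> univ M"
    using strong_setsD(2)[OF U(1)] .
  have UC: "U \<subseteq> univ \<CC>"
    using UM strong_univ[OF M(1)] by blast
  obtain h' where h': "aut h'" "\<And>x. x \<in> univ \<CC> \<Longrightarrow> h' (h x) = x"
    using aut_inverse[OF U(2)] by metis
  \<comment> \<open>Stage \<open>y\<close> put \<open>y\<close> in its image and \<open>q\<close>
    extends that stage, so \<open>y\<close> is the image under \<open>h\<close> of a point of
    \<open>U\<close>. Thus \<open>h'\<close> pulls all of \<open>b\<close> into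
    \<open>M\<close>.\<close>
  have hit: "h' y \<in> U" if "y \<in> ?R" for y
  proof -
    have "y \<in> snd (F y) ` fst (F y)"
      using F[of y] that by (simp add: P_def)
    then obtain z where "z \<in> fst (F y)" "y = snd (F y) z"
      by blast
    then have "z \<in> U" "y = h z"
      using q(2)[OF that] by (auto simp: extends_def qU split: prod.splits)
    then show ?thesis
      using h'(2) UC by auto
  qed
  show thesis
  proof
    have "h' x = x" if "x \<in> ?X" for x
      using h'(2)[of x] U(3) U(4)[OF that] UC that by auto
    then show "map_option h' \<circ> b \<in> gtp K \<CC> b ?X"
      using h'(1) by (auto simp: gtp_def)
    show "ran (map_option h' \<circ> b) \<subseteq> univ M"
      using hit UM by (auto simp: ran_def)
  qed
qed

end

section \<open>Heirs and the order property\<close>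

lemma card_of_ran: "|ran c| \<le>o |dom c|"
proof -
  have "ran c = (the \<circ> c) ` dom c"
    by (force simp: ran_def dom_def image_iff)
  then show ?thesis
    using card_of_image by metis
qed

lemma map_option_cong_ran:
  "(\<And>x. x \<in> ran b \<Longrightarrow> f x = g x) \<Longrightarrow> map_option f \<circ> b = map_option g \<circ> b"
  by (auto simp: fun_eq_iff ranI intro!: option.map_cong0)

lemma map_option_id_ran:
  "(\<And>x. x \<in> ran b \<Longrightarrow> f x = x) \<Longrightarrow> map_option f \<circ> b = b"
  using map_option_cong_ran[of b f id] by (simp add: option.map_id0)

lemma map_option_comp_assoc: "map_option f \<circ> (map_option g \<circ> b) = map_option (f \<circ> g) \<circ> b"
  by (simp add: fun_eq_iff option.map_comp)

lemma gtp_dom: "c \<in> gtp K \<CC> b X \<Longrightarrow> dom c = dom b"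
  by (auto simp: gtp_def dom_def)

lemma gtp_antimono: "X \<subseteq> Y \<Longrightarrow> gtp K \<CC> b Y \<subseteq> gtp K \<CC> b X"
  by (auto simp: gtp_def)

text \<open>The sequences obtained from forking are indexed by a subset of \<open>I\<close>, whereas
  \<open>is_tuple\<close> asks for an initial segment of the cardinal; \<open>e\<close> transports
  the index set.\<close>

definition reindex :: "'k set \<Rightarrow> ('k \<Rightarrow> 'i) \<Rightarrow> ('i \<rightharpoonup> 'a) \<Rightarrow> 'k \<rightharpoonup> 'a" where
  "reindex S e c = (\<lambda>k. if k \<in> S then c (e k) else None)"

lemma reindex_map_option: "reindex S e (map_option g \<circ> c) = map_option g \<circ> reindex S e c"
  by (auto simp: reindex_def)

lemma dom_reindex: "e ` S \<subseteq> dom c \<Longrightarrow> dom (reindex S e c) = S"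
  by (auto simp: reindex_def dom_def split: if_splits)

lemma ran_reindex: "ran (reindex S e c) \<subseteq> ran c"
  by (auto simp: reindex_def ran_def split: if_splits)

lemma reindex_inj:
  assumes "dom c \<subseteq> e ` S" "dom d \<subseteq> e ` S" "reindex S e c = reindex S e d"
  shows "c = d"
proof
  fix i
  show "c i = d i"
  proof (cases "i \<in> e ` S")
    case True
    then obtain k where "k \<in> S" "i = e k"
      by blast
    then show ?thesis
      using fun_cong[OF assms(3), of k] by (simp add: reindex_def)
  next
    case False
    then show ?thesis
      using assms(1,2) by (metis domIff subsetD)
  qed
qed

text \<open>Reindexing commutes with automorphisms, which gives one direction. The converse holds
  because it loses nothing about sequences whose domain is the image of \<open>S\<close> under
  \<open>e\<close>.\<close>

lemma reindex_gtp:
  assumes "dom c = e ` S" "dom b = e ` S"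
  shows "reindex S e c \<in> gtp K \<CC> (reindex S e b) X \<longleftrightarrow> c \<in> gtp K \<CC> b X"
proof
  assume "reindex S e c \<in> gtp K \<CC> (reindex S e b) X"
  then obtain g where g: "struct_iso (lang K) g \<CC> \<CC>" "\<forall>x\<in>X. g x = x"
      "reindex S e c = reindex S e (map_option g \<circ> b)"
    by (auto simp: gtp_def reindex_map_option)
  have "dom (map_option g \<circ> b) \<subseteq> e ` S"
    using assms(2) by (auto simp: dom_def)
  then have "c = map_option g \<circ> b"
    using reindex_inj g(3) assms(1) by (metis order_refl)
  then show "c \<in> gtp K \<CC> b X"
    using g(1,2) by (auto simp: gtp_def)
next
  assume "c \<in> gtp K \<CC> b X"
  then show "reindex S e c \<in> gtp K \<CC> (reindex S e b) X"
    by (auto simp: gtp_def reindex_map_option)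
qed

section \<open>Galois types as orbits\<close>

context monster_aec begin

lemma gtp_self: "b \<in> gtp K \<CC> b X"
  using aut_id by (auto simp: gtp_def option.map_id0 intro!: exI[of _ id])

lemma gtp_trans:
  assumes "c \<in> gtp K \<CC> b X" "d \<in> gtp K \<CC> c X"
  shows "d \<in> gtp K \<CC> b X"
proof -
  obtain g where g: "aut g" "\<forall>x\<in>X. g x = x" "c = map_option g \<circ> b"
    using assms(1) by (auto simp: gtp_def)
  obtain h where h: "aut h" "\<forall>x\<in>X. h x = x" "d = map_option h \<circ> c"
    using assms(2) by (auto simp: gtp_def)
  have "d = map_option (h \<circ> g) \<circ> b"
    using g(3) h(3) by (simp add: map_option_comp_assoc)
  moreover have "\<forall>x\<in>X. (h \<circ> g) x = x"
    using g(2) h(2) by simp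
  ultimately show ?thesis
    using aut_comp[OF g(1) h(1)] unfolding gtp_def by blast
qed

text \<open>The inverse automorphism cancels only on the universe of \<CC>, hence the two inclusions
  among the hypotheses.\<close>

lemma gtp_sym:
  assumes "c \<in> gtp K \<CC> b X" "ran b \<subseteq> univ \<CC>" "X \<subseteq> univ \<CC>"
  shows "b \<in> gtp K \<CC> c X"
proof -
  obtain g where g: "aut g" "\<forall>x\<in>X. g x = x" "c = map_option g \<circ> b"
    using assms(1) by (auto simp: gtp_def)
  obtain h where h: "aut h" "\<And>x. x \<in> univ \<CC> \<Longrightarrow> h (g x) = x"
    using aut_inverse[OF g(1)] by metis
  have "map_option h \<circ> c = b"
    unfolding g(3) map_option_comp_assoc using h(2) assms(2) by (intro map_option_id_ran) auto
  moreover have "\<forall>x\<in>X. h x = x"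
    using g(2) h(2) assms(3) by (metis subsetD)
  ultimately show ?thesis
    using h(1) unfolding gtp_def by blast
qed

lemma gtp_eq:
  assumes "c \<in> gtp K \<CC> b X" "ran b \<subseteq> univ \<CC>" "X \<subseteq> univ \<CC>"
  shows "gtp K \<CC> c X = gtp K \<CC> b X"
  using gtp_trans gtp_sym[OF assms] assms(1) by blast

lemma type_sub_gtp: "type_sub (gtp K \<CC> a X) I0 = gtp K \<CC> (a |` I0) X"
proof -
  have "(map_option g \<circ> a) |` I0 = map_option g \<circ> (a |` I0)" for g :: "'a \<Rightarrow> 'a"
    by (auto simp: restrict_map_def)
  then show ?thesis
    by (simp add: type_sub_def gtp_def setcompr_eq_image image_image)
qed

lemma type_restrict_gtp:
  assumes "X \<subseteq> Y"
  shows "type_restrict K \<CC> (gtp K \<CC> a Y) X = gtp K \<CC> a X"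
  using gtp_self[of a Y] gtp_trans[of _ a X] gtp_antimono[OF assms, of K \<CC> a]
  unfolding type_restrict_def by blast

text \<open>The automorphism provided by the heir property can be corrected by one fixing the image of
  \<open>N'\<close> so that it fixes the realization \<open>A\<close> itself, and not only its type.\<close>

lemma heir_automorphism:
  fixes A :: "'i \<rightharpoonup> 'a"
  assumes MN: "M \<preceq>\<^bsub>K\<^esub> N" "N \<preceq>\<^bsub>K\<^esub> \<CC>"
    and A: "ran A \<subseteq> univ \<CC>" and heir: "heir_over K \<CC> \<kappa> I (gtp K \<CC> A (univ N)) M N"
    and I0: "I0 \<subseteq> I" "|I0| <o \<kappa>"
    and M': "M' \<preceq>\<^bsub>K\<^esub> M" "|univ M'| <o \<kappa>" "univ M' \<subseteq> univ N'"
    and N': "N' \<preceq>\<^bsub>K\<^esub> N" "|univ N'| <o \<kappa>"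
  obtains k where "aut k" "map_option k \<circ> (A |` I0) = A |` I0" "\<And>x. x \<in> univ M' \<Longrightarrow> k x = x"
    "k ` univ N' \<subseteq> univ M"
proof -
  let ?b = "A |` I0"
  have "M' \<preceq>\<^bsub>K\<^esub> N'"
    using strong_coherent[OF strong_trans[OF M'(1) MN(1)] N'(1) M'(3)] .
  then obtain f where f: "K_embedding K f N' M" "\<forall>x\<in>univ M'. f x = x"
      "type_image K \<CC> f (univ N') (type_restrict K \<CC> (gtp K \<CC> ?b (univ N)) (univ N')) =
       type_restrict K \<CC> (gtp K \<CC> ?b (univ N)) (f ` univ N')"
    using heir[unfolded heir_over_def type_sub_gtp, rule_format, OF I0(1), of "univ M'" N'] I0(2) M'(1,2) N'
    by blast
  obtain M1 where M1: "struct_iso L f N' M1" "M1 \<preceq>\<^bsub>K\<^esub> M"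
    using f(1) by (auto simp: K_embedding_def)
  have fN': "f ` univ N' = univ M1"
    using M1(1) by (auto simp: struct_iso_def bij_betw_def)
  have M1M: "univ M1 \<subseteq> univ M"
    using strong_univ[OF M1(2)] .
  have M1C: "M1 \<preceq>\<^bsub>K\<^esub> \<CC>"
    using M1(2) MN strong_trans by blast
  obtain g where g: "aut g" "\<And>x. x \<in> univ N' \<Longrightarrow> g x = f x"
    using aut_extends[OF strong_trans[OF N'(1) MN(2)] M1C less_kappa_less_mu[OF N'(2)] M1(1)] by metis
  \<comment> \<open>The image of \<open>?b\<close> under \<open>g\<close> realizes the transported
    type, which by the heir property is the type of \<open>?b\<close> over \<open>univ M1\<close>.
    So some \<open>h\<close> fixing \<open>univ M1\<close> moves \<open>?b\<close> to the same place
    as \<open>g\<close> does.\<close>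
  have "map_option g \<circ> ?b \<in> type_image K \<CC> f (univ N') (gtp K \<CC> ?b (univ N'))"
    using g gtp_self[of ?b "univ N'"] unfolding type_image_def by blast
  moreover have "univ M1 \<subseteq> univ N"
    using M1M strong_univ[OF MN(1)] by blast
  ultimately have "map_option g \<circ> ?b \<in> gtp K \<CC> ?b (univ M1)"
    using f(3) type_restrict_gtp[OF strong_univ[OF N'(1)]] type_restrict_gtp[of "univ M1" "univ N"] fN'
    by metis
  then obtain h where h: "aut h" "\<forall>x\<in>univ M1. h x = x" "map_option g \<circ> ?b = map_option h \<circ> ?b"
    by (auto simp: gtp_def)
  obtain h' where h': "aut h'" "\<And>x. x \<in> univ \<CC> \<Longrightarrow> h' (h x) = x"
    using aut_inverse[OF h(1)] by metis
  \<comment> \<open>The inverse of \<open>h\<close> brings \<open>?b\<close> back and is the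
    identity on the image of \<open>f\<close>, so composing with it does not disturb the values of
    \<open>f\<close>.\<close>
  have kN': "(h' \<circ> g) x = f x" if "x \<in> univ N'" for x
  proof -
    have "f x \<in> univ M1"
      using that fN' by blast
    then have "h (f x) = f x" "f x \<in> univ \<CC>"
      using h(2) strong_univ[OF M1C] by auto
    then show ?thesis
      using g(2)[OF that] h'(2)[of "f x"] by simp
  qed
  show thesis
  proof
    show "aut (h' \<circ> g)"
      using aut_comp[OF g(1) h'(1)] .
    have "map_option (h' \<circ> g) \<circ> ?b = map_option (h' \<circ> h) \<circ> ?b"
      unfolding map_option_comp_assoc[symmetric] h(3) ..
    also have "\<dots> = ?b"
      using A h'(2) by (intro map_option_id_ran) (auto dest!: subsetD[OF A] simp: ran_def restrict_map_def split: if_splits)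
    finally show "map_option (h' \<circ> g) \<circ> ?b = ?b" .
    show "(h' \<circ> g) x = x" if "x \<in> univ M'" for x
      using kN'[of x] f(2) M'(3) that by auto
    show "(h' \<circ> g) ` univ N' \<subseteq> univ M"
      using kN' fN' M1M by auto
  qed
qed

section \<open>The recursive construction of the order\<close>

lemma heir_forking_order:
  fixes A :: "'i \<rightharpoonup> 'a"
  assumes MN: "M \<preceq>\<^bsub>K\<^esub> N" "N \<preceq>\<^bsub>K\<^esub> \<CC>" and sat: "saturated K \<CC> \<kappa> M"
    and A: "dom A = I" "ran A \<subseteq> univ \<CC>"
    and heir: "heir_over K \<CC> \<kappa> I (gtp K \<CC> A (univ N)) M N"
    and I0: "I0 \<subseteq> I" "|I0| <o \<kappa>" and N0: "N0 \<preceq>\<^bsub>K\<^esub> N" "|univ N0| <o \<kappa>"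
    and omit: "\<And>c. c \<in> gtp K \<CC> (A |` I0) (univ N0) \<Longrightarrow> \<not> ran c \<subseteq> univ M"
  obtains cs Qs where
    "\<And>i. i \<in> Field \<kappa> \<Longrightarrow> ran (cs i) \<subseteq> univ M \<and> dom (cs i) = I0 \<and> Qs i \<preceq>\<^bsub>K\<^esub> M \<and> |univ (Qs i)| <o \<kappa>"
    "\<And>i j. i \<in> Field \<kappa> \<Longrightarrow> j \<in> Field \<kappa> \<Longrightarrow>
       (i, j) \<in> \<kappa> \<longleftrightarrow> cs j \<in> gtp K \<CC> (A |` I0) (univ (Qs i))"
proof -
  let ?b = "A |` I0"
  have MC: "M \<preceq>\<^bsub>K\<^esub> \<CC>"
    using MN strong_trans by blast
  have bC: "ran ?b \<subseteq> univ \<CC>"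
    using A(2) by (auto simp: ran_def restrict_map_def split: if_splits)
  have domb: "dom ?b = I0"
    using A(1) I0(1) by auto
  have wo: "Well_order \<kappa>"
    using Card_order_kappa by (rule card_order_on_well_order_on)
  have wf: "wf (\<kappa> - Id)" and tot: "Total \<kappa>" and refl: "Refl \<kappa>"
    using wo by (simp_all add: order_on_defs well_order_on_def)
  \<comment> \<open>The pair \<open>q\<close> consists of the new sequence and the new model. The
    model is bounded by \<open>|univ N0|\<close> and not just by \<kappa>, so that the union of all
    earlier stages stays small.\<close>
  define P where "P F i q \<longleftrightarrow> (i \<in> Field \<kappa> \<longrightarrow>
      ran (fst q) \<subseteq> univ M \<and> snd q \<preceq>\<^bsub>K\<^esub> M \<and> |univ (snd q)| \<le>o |univ N0| \<and>
      fst q \<in> gtp K \<CC> ?b (univ (snd q)) \<and>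
      (\<forall>j. (j, i) \<in> \<kappa> - Id \<longrightarrow>
         fst q \<in> gtp K \<CC> ?b (univ (snd (F j))) \<and> fst (F j) \<notin> gtp K \<CC> ?b (univ (snd q))))"
    for F :: "'k \<Rightarrow> ('i \<rightharpoonup> 'a) \<times> ('f, 'r, 'a) struct" and i q
  have "\<exists>F. \<forall>i. P F i (F i)"
  proof (rule dependent_wf_choice[OF wf])
    show "P F i q = P G i q" if "\<And>z. (z, i) \<in> \<kappa> - Id \<Longrightarrow> F z = G z" for F G i q
      using that by (auto simp: P_def)
    show "\<exists>q. P F i q" if IH: "\<And>j. (j, i) \<in> \<kappa> - Id \<Longrightarrow> P F j (F j)" for F i
    proof (cases "i \<in> Field \<kappa>")
      case True
      have IH': "ran (fst (F j)) \<subseteq> univ M" "univ (snd (F j)) \<subseteq> univ M"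
          "|univ (snd (F j))| \<le>o |univ N0|" "|ran (fst (F j))| \<le>o |I0|"
        if "j \<in> underS \<kappa> i" for j
      proof -
        have "P F j (F j)" "j \<in> Field \<kappa>"
          using IH[of j] that by (auto simp: underS_def Field_def)
        then have "ran (fst (F j)) \<subseteq> univ M" "snd (F j) \<preceq>\<^bsub>K\<^esub> M"
          and sz: "|univ (snd (F j))| \<le>o |univ N0|" and mem: "fst (F j) \<in> gtp K \<CC> ?b (univ (snd (F j)))"
          by (simp_all add: P_def)
        then show "ran (fst (F j)) \<subseteq> univ M" "univ (snd (F j)) \<subseteq> univ M"
          using strong_univ by auto
        show "|univ (snd (F j))| \<le>o |univ N0|"
          by (rule sz)
        show "|ran (fst (F j))| \<le>o |I0|"
          using card_of_ran[of "fst (F j)"] gtp_dom[OF mem] domb by simp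
      qed
      define S where "S = (\<Union>j\<in>underS \<kappa> i. univ (snd (F j)) \<union> ran (fst (F j)))"
      have SM: "S \<subseteq> univ M"
        using IH'(1,2) by (auto simp: S_def)
      \<comment> \<open>Realizations of the type of \<open>?b\<close> keep its domain
        \<open>I0\<close>, so all earlier sequences and models have sizes bounded by one
        \<open>B\<close>; regularity of \<kappa> is not assumed.\<close>
      have "|S| <o \<kappa>"
      proof -
        obtain B :: "(('a + 'i) + 'k + 'l) set" where B: "|B| <o \<kappa>" "|univ N0 <+> I0| \<le>o |B|"
            "|underS \<kappa> i| \<le>o |B|" "infinite B"
          using common_bound[OF Plus_less_kappa[OF N0(2) I0(2)] card_of_underS[OF Card_order_kappa True]]
          by metis
        have "|univ (snd (F j)) \<union> ran (fst (F j))| \<le>o |B|" if "j \<in> underS \<kappa> i" for j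
        proof (rule Un_Cinfinite_bound)
          show "|univ (snd (F j))| \<le>o |B|"
            using IH'(3)[OF that] card_of_Plus1 B(2) ordLeq_transitive by metis
          show "|ran (fst (F j))| \<le>o |B|"
            using IH'(4)[OF that] card_of_Plus2 B(2) ordLeq_transitive by metis
        qed (rule Cinfinite_card_of[OF B(4)])
        then have "|S| \<le>o |B|"
          unfolding S_def by (intro card_of_UNION_ordLeq_infinite[OF B(4,3)] ballI)
        then show ?thesis
          using B(1) by (rule ordLeq_ordLess_trans)
      qed
      \<comment> \<open>\<open>M1\<close> collects everything chosen so far and is to be fixed;
        \<open>N'\<close> adds \<open>N0\<close>, which is to be moved into
        \<open>M\<close>.\<close>
      then obtain M1 where M1: "M1 \<preceq>\<^bsub>K\<^esub> M" "S \<subseteq> univ M1" "|univ M1| <o \<kappa>"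
        using small_LS[OF _ SM] strong_models[OF MC] by metis
      have "univ M1 \<union> univ N0 \<subseteq> univ N"
        using strong_univ[OF M1(1)] strong_univ[OF MN(1)] strong_univ[OF N0(1)] by blast
      then obtain N' where N': "N' \<preceq>\<^bsub>K\<^esub> N" "univ M1 \<union> univ N0 \<subseteq> univ N'" "|univ N'| <o \<kappa>"
        using small_LS[of N "univ M1 \<union> univ N0"] Un_less_kappa[OF M1(3) N0(2)] strong_models[OF MN(2)]
        by metis
      have M1N': "univ M1 \<subseteq> univ N'"
        using N'(2) by blast
      obtain k where k: "aut k" "map_option k \<circ> ?b = ?b" "\<And>x. x \<in> univ M1 \<Longrightarrow> k x = x"
          "k ` univ N' \<subseteq> univ M"
        using heir_automorphism[OF MN A(2) heir I0 M1(1,3) M1N' N'(1,3)] by metis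
      let ?Q = "k ` univ N0"
      have N0C: "univ N0 \<subseteq> univ \<CC>"
        using strong_univ[OF N0(1)] strong_univ[OF MN(2)] by blast
      have "?Q \<in> strong_sets K \<CC>"
        using strong_sets_image[OF strong_setsI[OF strong_trans[OF N0(1) MN(2)]] k(1)] .
      moreover have QM: "?Q \<subseteq> univ M"
        using k(4) N'(2) by blast
      ultimately have Q: "induced L M ?Q \<preceq>\<^bsub>K\<^esub> M"
        using strong_sets_coherent[OF _ MC] strong_setsD(1) by blast
      have "|?Q| <o \<kappa>"
        using card_of_image N0(2) by (rule ordLeq_ordLess_trans)
      then have "|univ M1 \<union> ?Q| <o \<kappa>"
        using Un_less_kappa[OF M1(3)] by blast
      moreover have "univ M1 \<union> ?Q \<subseteq> univ M"
        using QM strong_univ[OF M1(1)] by blast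
      \<comment> \<open>\<open>M2\<close> contains all earlier models and the new copy
        \<open>?Q\<close>, so one application of saturation handles all these types at once.\<close>
      ultimately obtain M2 where M2: "M2 \<preceq>\<^bsub>K\<^esub> M" "univ M1 \<union> ?Q \<subseteq> univ M2" "|univ M2| <o \<kappa>"
        using small_LS[of M "univ M1 \<union> ?Q"] strong_models[OF MC] by metis
      have "|ran ?b| <o \<kappa>"
        using card_of_ran[of ?b] I0(2) unfolding domb by (rule ordLeq_ordLess_trans)
      then obtain c where c: "c \<in> gtp K \<CC> ?b (univ M2)" "ran c \<subseteq> univ M"
        using saturated_realizes[OF MC sat M2(1,3) bC] by metis
      have cX: "c \<in> gtp K \<CC> ?b X" if "X \<subseteq> univ M2" for X
        using c(1) gtp_antimono[OF that] by blast
      \<comment> \<open>Suppose \<open>h\<close> fixes \<open>?Q\<close> and sends \<open>?b\<close>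
        to \<open>d\<close>. As \<open>k\<close> fixes \<open>?b\<close> and \<open>M1\<close>,
        conjugating \<open>h\<close> by \<open>k\<close> gives an automorphism that fixes
        \<open>N0\<close> and still sends \<open>?b\<close> to \<open>d\<close>. So \<open>d\<close>
        would realize in \<open>M\<close> the type omitted there.\<close>
      have new: "d \<notin> gtp K \<CC> ?b ?Q" if d: "ran d \<subseteq> univ M1" for d
      proof
        assume "d \<in> gtp K \<CC> ?b ?Q"
        then obtain h where h: "aut h" "\<forall>x\<in>?Q. h x = x" "d = map_option h \<circ> ?b"
          by (auto simp: gtp_def)
        obtain k' where k': "aut k'" "\<And>x. x \<in> univ \<CC> \<Longrightarrow> k' (k x) = x"
          using aut_inverse[OF k(1)] by metis
        have dC: "ran d \<subseteq> univ M"
          using d strong_univ[OF M1(1)] by blast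
        have "k' x = x" if "x \<in> ran d" for x
          using k'(2)[of x] k(3)[of x] that d dC strong_univ[OF MC] by (metis subsetD)
        then have "d = map_option k' \<circ> d"
          by (simp add: map_option_id_ran)
        also have "\<dots> = map_option k' \<circ> (map_option h \<circ> (map_option k \<circ> ?b))"
          using h(3) k(2) by simp
        also have "\<dots> = map_option (k' \<circ> (h \<circ> k)) \<circ> ?b"
          by (simp only: map_option_comp_assoc)
        finally have "d = map_option (k' \<circ> (h \<circ> k)) \<circ> ?b" .
        moreover have "aut (k' \<circ> (h \<circ> k))"
          using aut_comp k(1) k'(1) h(1) by blast
        moreover have "\<forall>x\<in>univ N0. (k' \<circ> (h \<circ> k)) x = x"
          using h(2) k'(2) N0C by auto
        ultimately have "d \<in> gtp K \<CC> ?b (univ N0)"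
          unfolding gtp_def by blast
        then show False
          using omit dC by blast
      qed
      have "P F i (c, induced L M ?Q)"
        unfolding P_def
      proof (intro impI conjI allI)
        fix j assume "(j, i) \<in> \<kappa> - Id"
        then have "j \<in> underS \<kappa> i"
          by (simp add: underS_def)
        then have "univ (snd (F j)) \<subseteq> univ M1" "ran (fst (F j)) \<subseteq> univ M1"
          using M1(2) by (auto simp: S_def)
        then show "fst (c, induced L M ?Q) \<in> gtp K \<CC> ?b (univ (snd (F j)))"
          and "fst (F j) \<notin> gtp K \<CC> ?b (univ (snd (c, induced L M ?Q)))"
          using cX M2(2) new by auto
      qed (use c(2) Q cX M2(2) in \<open>auto simp: card_of_image\<close>)
      then show ?thesis ..
    qed (simp add: P_def)
  qed
  then obtain F where F: "\<And>i. P F i (F i)"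
    by blast
  show thesis
  proof
    fix i assume i: "i \<in> Field \<kappa>"
    show "ran (fst (F i)) \<subseteq> univ M \<and> dom (fst (F i)) = I0 \<and> snd (F i) \<preceq>\<^bsub>K\<^esub> M \<and> |univ (snd (F i))| <o \<kappa>"
      using F[of i] i gtp_dom[of "fst (F i)" K \<CC> ?b] domb ordLeq_ordLess_trans[OF _ N0(2)]
      by (auto simp: P_def)
    fix j assume j: "j \<in> Field \<kappa>"
    \<comment> \<open>Equal indices: each sequence realizes the type over its own model. Otherwise
      the invariant at the later index decides: the later sequence realizes the type over the
      earlier model, but not conversely.\<close>
    consider "i = j" | "(i, j) \<in> \<kappa> - Id" | "(j, i) \<in> \<kappa> - Id" "(i, j) \<notin> \<kappa>"
      using i j tot by (auto simp: total_on_def)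
    then show "(i, j) \<in> \<kappa> \<longleftrightarrow> fst (F j) \<in> gtp K \<CC> ?b (univ (snd (F i)))"
    proof cases
      case 1
      then show ?thesis
        using F[of i] i refl by (simp add: P_def refl_on_def)
    next
      case 2
      then show ?thesis
        using F[of j] j by (simp add: P_def)
    next
      case 3
      then show ?thesis
        using F[of i] i by (simp add: P_def)
    qed
  qed
qed

end

section \<open>The order property witnessed in the saturated model\<close>

theorem theorem6p5:
  fixes K :: "('f, 'r, 'a) class_data"
    and \<CC> M N :: "('f, 'r, 'a) struct"
    and l :: "'l rel" and \<kappa> :: "'k rel" and \<mu> :: "'m rel"
    and I :: "'i set" and p :: "('i \<rightharpoonup> 'a) set"
  assumes "is_aec K l"
    and "amalgamation K" and "joint_embedding K" and "no_maximal_models K"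
    and "Card_order \<kappa>" and "l <o \<kappa>"
    and "Card_order \<mu>" and "\<kappa> \<le>o \<mu>" and "monster K \<mu> \<CC>"
    and "M \<preceq>\<^bsub>K\<^esub> N" and "N \<preceq>\<^bsub>K\<^esub> \<CC>" and "|univ N| <o \<mu>"
    and "saturated K \<CC> \<kappa> M"
    and "p \<in> gS K \<CC> I N"
    and "heir_over K \<CC> \<kappa> I p M N"
    and "forks_over K \<CC> \<kappa> p M N"
  shows "order2_property K \<CC> \<kappa> \<kappa> \<and>
    (\<exists>b bs Ns. order2_witness K \<CC> \<kappa> \<kappa> b bs Ns \<and>
       (\<forall>i\<in>Field \<kappa>. ran (bs i) \<subseteq> univ M \<and> Ns i \<preceq>\<^bsub>K\<^esub> M))"
proof -
  interpret monster_aec K l \<kappa> \<mu> \<CC>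
    by unfold_locales (use assms in auto)
  have MC: "M \<preceq>\<^bsub>K\<^esub> \<CC>"
    using assms(10,11) strong_trans by blast
  obtain a where a: "p = gtp K \<CC> a (univ N)" "dom a = I" "ran a \<subseteq> univ \<CC>"
    using assms(14) by (auto simp: gS_def)
  obtain A where A: "A \<in> p" "\<not> nonforking K \<CC> \<kappa> A M N"
    using assms(16) by (auto simp: forks_over_def)
  have domA: "dom A = I"
    using gtp_dom A(1) a by metis
  have ranA: "ran A \<subseteq> univ \<CC>"
    using A(1) a(3) aut_in by (fastforce simp: a(1) gtp_def ran_def)
  \<comment> \<open>The realization \<open>A\<close> witnessing forking need not be the
    representative \<open>a\<close>, but \<open>p\<close> is equally the orbit of
    \<open>A\<close>.\<close>
  have "gtp K \<CC> A (univ N) = p"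
    using gtp_eq[OF _ a(3) strong_univ[OF assms(11)]] A(1) a(1) by blast
  then have heir: "heir_over K \<CC> \<kappa> I (gtp K \<CC> A (univ N)) M N"
    using assms(15) by simp
  obtain I0 N0 where I0: "I0 \<subseteq> I" "|I0| <o \<kappa>" and N0: "N0 \<preceq>\<^bsub>K\<^esub> N" "|univ N0| <o \<kappa>"
    and omit: "\<And>c. c \<in> gtp K \<CC> (A |` I0) (univ N0) \<Longrightarrow> \<not> ran c \<subseteq> univ M"
    using A(2) domA unfolding nonforking_def by blast
  obtain cs Qs where
    cs: "\<And>i. i \<in> Field \<kappa> \<Longrightarrow> ran (cs i) \<subseteq> univ M \<and> dom (cs i) = I0 \<and> Qs i \<preceq>\<^bsub>K\<^esub> M \<and> |univ (Qs i)| <o \<kappa>"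
    and ord: "\<And>i j. i \<in> Field \<kappa> \<Longrightarrow> j \<in> Field \<kappa> \<Longrightarrow>
       (i, j) \<in> \<kappa> \<longleftrightarrow> cs j \<in> gtp K \<CC> (A |` I0) (univ (Qs i))"
    using heir_forking_order[OF assms(10,11,13) domA ranA heir I0 N0 omit] by metis
  have wo: "Well_order \<kappa>"
    using Card_order_kappa by (rule card_order_on_well_order_on)
  \<comment> \<open>Since \<open>|I0|\<close> is below \<kappa>, it is isomorphic to a proper
    initial segment of \<kappa>, which serves as the common domain of all the tuples.\<close>
  obtain x where x: "x \<in> Field \<kappa>" "|I0| =o Restr \<kappa> (underS \<kappa> x)"
    using I0(2) ordLess_iff_ordIso_Restr[OF wo card_of_Well_order] by blast
  let ?S = "underS \<kappa> x"
  have "Field (Restr \<kappa> ?S) = ?S"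
    using wo by (intro Refl_Field_Restr2) (auto simp: order_on_defs well_order_on_def underS_def Field_def)
  then obtain e where e: "bij_betw e ?S I0"
    using x(2) ordIso_symmetric[OF x(2)] unfolding ordIso_def iso_def by (auto simp: Field_card_of)
  then have eS: "e ` ?S = I0"
    by (simp add: bij_betw_def)
  let ?b = "A |` I0"
  have domb: "dom ?b = I0"
    using domA I0(1) by auto
  have ranb: "ran ?b \<subseteq> univ \<CC>"
    using ranA by (auto simp: ran_def restrict_map_def split: if_splits)
  define bs where "bs i = reindex ?S e (cs i)" for i
  have dom_bs: "dom (bs i) = ?S" and ran_bs: "ran (bs i) \<subseteq> univ M" if "i \<in> Field \<kappa>" for i
    using cs[OF that] dom_reindex[of e ?S "cs i"] ran_reindex[of ?S e "cs i"] eS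
    by (auto simp: bs_def)
  have "order2_witness K \<CC> \<kappa> \<kappa> (reindex ?S e ?b) bs Qs"
    unfolding order2_witness_def
  proof (intro conjI ballI)
    have "dom (reindex ?S e ?b) = ?S"
      by (rule dom_reindex) (simp only: eS domb order_refl)
    then show "is_tuple \<kappa> \<CC> (reindex ?S e ?b)"
      using x(1) ran_reindex[of ?S e ?b] ranb unfolding is_tuple_def by blast
    fix i assume i: "i \<in> Field \<kappa>"
    show "is_tuple \<kappa> \<CC> (bs i)"
      using x(1) dom_bs[OF i] ran_bs[OF i] strong_univ[OF MC] by (auto simp: is_tuple_def)
    show "Qs i \<preceq>\<^bsub>K\<^esub> \<CC>"
      using cs[OF i] MC strong_trans by blast
    show "|dom (bs i)| +c |univ (Qs i)| <o \<kappa>"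
      unfolding csum_def Field_card_of dom_bs[OF i]
      using card_of_underS[OF Card_order_kappa x(1)] cs[OF i] by (intro Plus_less_kappa) auto
    fix j assume j: "j \<in> Field \<kappa>"
    show "(i, j) \<in> \<kappa> \<longleftrightarrow> bs j \<in> gtp K \<CC> (reindex ?S e ?b) (univ (Qs i))"
      using ord[OF i j] reindex_gtp[of "cs j" e ?S ?b K \<CC> "univ (Qs i)"] cs[OF j] eS domb by (simp add: bs_def)
  qed
  then show ?thesis
    unfolding order2_property_def using ran_bs cs by blast
qed

end
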